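(* Let $P \in \mathbb{R}[x]$ be a polynomial such that the coefficient of $x$ in $P$ is non-Liouville. Let $$S(X) := \#\{x \in \mathbb{N} : x \le X,\ \gcd(x, \lfloor P(x) \rfloor) = 1\}.$$ Then, as $X \to \infty$, $$S(X) = \frac{X}{\zeta(2)} + O\!\left(\frac{X}{(\log\log X)^{1/3}}\right),$$ and hence $\displaystyle\lim_{X\to\infty} \frac{S(X)}{X} = \frac{1}{\zeta(2)}$.
   Context: A real number $\alpha$ is called Liouville if for every $n \in \mathbb{N}$ there exists a pair of integers $(p,q)$ with $q>1$ such that $\left|\alpha - \frac{p}{q}\right| \le q^{-n}$; it is non-Liouville if it is not Liouville. $\zeta$ is the Riemann zeta function, so $1/\zeta(2) = 6/\pi^2$. $\lfloor \cdot \rfloor$ denotes the floor function. *)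

theory Defs
  imports
    "HOL-Analysis.Analysis"
    "HOL-Computational_Algebra.Polynomial"
    "HOL-Library.Landau_Symbols"
begin

text \<open>The denominator is only required to exceed 1, and equality \<open>\<alpha> = p / q\<close> is allowed.
  Hence every rational number is Liouville in this sense.\<close>

definition liouville :: "real \<Rightarrow> bool" where
  "liouville \<alpha> \<longleftrightarrow>
     (\<forall>n::nat. n \<ge> 1 \<longrightarrow>
       (\<exists>p q :: int. q > 1 \<and> \<bar>\<alpha> - real_of_int p / real_of_int q\<bar> \<le> 1 / real_of_int q ^ n))"

text \<open>The Riemann zeta function on the half-line \<open>s > 1\<close>, given by its Dirichlet series.
  For \<open>s \<le> 1\<close> the series diverges and the value is meaningless.\<close>

definition zeta :: "real \<Rightarrow> real" where
  "zeta s = (\<Sum>n. 1 / real (Suc n) powr s)"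

text \<open>Natural numbers start at 1. The floor of \<open>P(x)\<close> can be negative or zero, so
  the gcd is taken over the integers.\<close>

definition coprime_floor_count :: "real poly \<Rightarrow> real \<Rightarrow> nat" where
  "coprime_floor_count P X =
     card {x::nat. 1 \<le> x \<and> real x \<le> X \<and> gcd (int x) \<lfloor>poly P (real x)\<rfloor> = 1}"

lemma zeta_2: "zeta 2 = pi\<^sup>2 / 6"
proof -
  have "(\<lambda>n. 1 / real (Suc n) powr 2) sums (pi\<^sup>2 / 6)"
    using inverse_squares_sums by (simp add: powr_numeral add.commute)
  thus ?thesis
    unfolding zeta_def by (rule sums_unique [symmetric])
qed

end

theory Submission
  imports Defs "HOL-Real_Asymp.Real_Asymp"
begin

text \<open>
  Write \<open>e(t) = exp(2\<pi>it)\<close>. For \<open>d\<close> dividing \<open>x = dy\<close>, the condition \<open>d\<close> divides \<open>\<lfloor>P(x)\<rfloor>\<close>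
  says that the fractional part of \<open>P(dy) / d\<close> is less than \<open>1 / d\<close>. As a polynomial in \<open>y\<close> this has
  the same linear coefficient \<open>\<alpha>\<close> as \<open>P\<close>, whatever \<open>d\<close> is. So everything rests on equidistribution
  modulo 1, with a power saving, that is uniform over all polynomials of bounded degree with linear
  coefficient \<open>\<alpha>\<close>.

  If an exponential sum of length \<open>N\<close> over such a polynomial is at least \<open>N / M\<close>, then the leading
  coefficient is close to a rational with denominator at most a power of \<open>M\<close> (Weyl differencing). The
  leading term is then removed by partial summation and by additive characters, which only shift
  \<open>\<alpha>\<close> by a rational with small denominator. By induction on the degree \<open>\<alpha>\<close> itself has a rational
  approximation of quality \<open>M\<^sup>K / N\<close>, contradicting that it is not Liouville once \<open>N\<close> is
  larger than a power of \<open>M\<close>.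

  The count itself is sieved: primes up to \<open>z \<approx> log log X\<close> by inclusion-exclusion, giving the truncated
  Euler product of \<open>1 / \<zeta>(2)\<close>; primes between \<open>z\<close> and \<open>X / W\<close>, with \<open>W\<close> a power of \<open>log X\<close>, by
  equidistribution again; and larger primes trivially, since by Chebyshev's bound few integers up to
  \<open>X\<close> have a prime factor exceeding \<open>X / W\<close>.
\<close>

section \<open>Distance to the nearest integer and the strong recurrence lemma\<close>

definition nid :: "real \<Rightarrow> real" where
  "nid x = \<bar>x - of_int (round x)\<bar>"

lemma nid_nonneg [simp]: "0 \<le> nid x"
  by (simp add: nid_def)

lemma nid_le_half: "nid x \<le> 1 / 2"
  unfolding nid_def using of_int_round_abs_le[of x] by linarith

lemma nid_le: "nid x \<le> \<bar>x - of_int m\<bar>"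
  unfolding nid_def by (rule round_diff_minimal)

lemma nid_leI: "\<bar>x - of_int m\<bar> \<le> e \<Longrightarrow> nid x \<le> e"
  using nid_le order_trans by blast

lemma nidE:
  obtains m :: int where "nid x = \<bar>x - of_int m\<bar>"
  using that unfolding nid_def by blast

lemma nid_add_le: "nid (x + y) \<le> nid x + nid y"
proof -
  obtain m where m: "nid x = \<bar>x - of_int m\<bar>" by (rule nidE)
  obtain n where n: "nid y = \<bar>y - of_int n\<bar>" by (rule nidE)
  show ?thesis unfolding m n by (rule nid_leI[of _ "m + n"]) simp
qed

lemma nid_minus [simp]: "nid (- x) = nid x"
proof -
  have le: "nid (- x) \<le> nid x" for x
  proof -
    obtain m where m: "nid x = \<bar>x - of_int m\<bar>" by (rule nidE)
    show ?thesis unfolding m by (rule nid_leI[of _ "- m"]) simp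
  qed
  from le[of x] le[of "- x"] show ?thesis by simp
qed

lemma nid_diff_le: "nid (x - y) \<le> nid x + nid y"
  using nid_add_le[of x "- y"] by simp

lemma nid_of_int [simp]: "nid (of_int m) = 0"
  by (simp add: nid_def)

lemma nid_add_int [simp]: "nid (x + of_int m) = nid x"
  using nid_add_le[of x "of_int m"] nid_diff_le[of "x + of_int m" "of_int m"] by simp

lemma nid_mult_nat_le: "nid (real n * x) \<le> real n * nid x"
proof -
  obtain m where m: "nid x = \<bar>x - of_int m\<bar>" by (rule nidE)
  have "\<bar>real n * x - of_int (int n * m)\<bar> = real n * \<bar>x - of_int m\<bar>"
    by (simp add: abs_mult flip: right_diff_distrib)
  thus ?thesis unfolding m by (intro nid_leI[of _ "int n * m"]) simp
qed

section \<open>Additive characters and geometric sums\<close>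

definition ecis :: "real \<Rightarrow> complex" where
  "ecis x = cis (2 * pi * x)"

lemma norm_ecis [simp]: "norm (ecis x) = 1"
  by (simp add: ecis_def)

lemma ecis_add: "ecis (x + y) = ecis x * ecis y"
  by (simp add: ecis_def cis_mult algebra_simps)

lemma cnj_ecis: "cnj (ecis x) = ecis (- x)"
  by (simp add: ecis_def cis_cnj)

lemma ecis_of_int [simp]: "ecis (of_int m) = 1"
  by (simp add: ecis_def)

lemma ecis_0 [simp]: "ecis 0 = 1"
  by (simp add: ecis_def)

lemma ecis_add_int [simp]: "ecis (x + of_int m) = ecis x"
  by (simp add: ecis_add)

lemma ecis_eq_if_diff_int: "x - y = of_int m \<Longrightarrow> ecis x = ecis y"
  using ecis_add_int[of y m] by (simp add: algebra_simps)

lemma norm_cis_minus_1: "norm (cis t - 1) = 2 * \<bar>sin (t / 2)\<bar>"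
proof -
  have "(norm (cis t - 1))\<^sup>2 = (cos t - 1)\<^sup>2 + (sin t)\<^sup>2"
    by (simp add: cmod_power2)
  also have "\<dots> = 2 - 2 * cos t"
    using sin_cos_squared_add[of t] by (simp add: power2_eq_square algebra_simps)
  also have "\<dots> = (2 * \<bar>sin (t / 2)\<bar>)\<^sup>2"
    using cos_double_sin[of "t / 2"] by (simp add: power_mult_distrib)
  finally show ?thesis by (rule power2_eq_imp_eq) auto
qed

lemma norm_ecis_diff_le: "norm (ecis x - ecis y) \<le> 2 * pi * \<bar>x - y\<bar>"
proof -
  have "ecis x - ecis y = ecis y * (ecis (x - y) - 1)"
    using ecis_add[of y "x - y"] by (simp add: algebra_simps)
  hence "norm (ecis x - ecis y) = 2 * \<bar>sin (pi * (x - y))\<bar>"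
    by (simp add: norm_mult ecis_def norm_cis_minus_1)
  also have "\<dots> \<le> 2 * \<bar>pi * (x - y)\<bar>"
    using abs_sin_x_le_abs_x by (intro mult_left_mono) auto
  finally show ?thesis by (simp add: abs_mult)
qed

text \<open>A weak Jordan inequality: up to pi/3 the mean value theorem applies with cosine at least
  1/2, and beyond it the sine is at least \<open>sqrt 3 / 2\<close> while x < 2.\<close>

lemma sin_ge_third_self:
  fixes x :: real
  assumes "0 \<le> x" "x \<le> pi / 2"
  shows "x / 3 \<le> sin x"
proof (cases "x \<le> pi / 3")
  case True
  show ?thesis
  proof (cases "x = 0")
    case False
    hence "0 < x" using assms by simp
    then obtain z where z: "0 < z" "z < x" "sin x - sin 0 = (x - 0) * cos z"
      using MVT2[of 0 x sin cos] by (auto intro: DERIV_sin)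
    have "cos z \<ge> cos (pi / 3)"
      using z True by (intro cos_monotone_0_pi_le) auto
    hence "x * cos z \<ge> x * (1 / 3)"
      using assms by (intro mult_left_mono) (auto simp: cos_60)
    thus ?thesis using z by simp
  qed auto
next
  case False
  have "sin (pi / 3) \<le> sin x"
    using False assms pi_gt_zero by (intro sin_monotone_2pi_le) auto
  moreover have "x < 2" using assms pi_less_4 by linarith
  moreover have "sqrt 3 / 2 \<ge> 2 / 3"
    by (rule order_trans[OF _ divide_right_mono[OF real_le_rsqrt[of "4/3"]]]) (auto simp: power2_eq_square)
  ultimately show ?thesis by (simp add: sin_60)
qed

text \<open>With t = \<open>nid x\<close>, the right-hand side is the chord 2 sin(pi t), and the
  weak sine bound already makes this at least t.\<close>

lemma nid_le_norm_ecis: "nid x \<le> norm (ecis x - 1)"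
proof -
  obtain m where m: "nid x = \<bar>x - of_int m\<bar>" by (rule nidE)
  define t where "t = \<bar>x - of_int m\<bar>"
  have t: "0 \<le> t" "t \<le> 1 / 2" using m nid_le_half[of x] by (auto simp: t_def)
  have "norm (ecis x - 1) = norm (ecis (x - of_int m) - 1)"
    using ecis_add_int[of "x - of_int m" m] by simp
  also have "\<dots> = 2 * \<bar>sin (pi * (x - of_int m))\<bar>"
    by (simp add: ecis_def norm_cis_minus_1)
  also have "\<bar>sin (pi * (x - of_int m))\<bar> = \<bar>sin (pi * t)\<bar>"
    unfolding t_def by (cases "x \<ge> of_int m") (auto simp: abs_if right_diff_distrib sin_diff)
  finally have eq: "norm (ecis x - 1) = 2 * \<bar>sin (pi * t)\<bar>" .
  have "pi * t \<le> pi * (1 / 2)" using t by (intro mult_left_mono) auto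
  hence "pi * t / 3 \<le> sin (pi * t)"
    using t by (intro sin_ge_third_self) auto
  moreover have "2 * t \<le> pi * t" using t pi_ge_two by (intro mult_right_mono) auto
  ultimately show ?thesis using t unfolding eq m t_def[symmetric] by linarith
qed

lemma sum_int_telescope:
  fixes f :: "int \<Rightarrow> 'a :: ab_group_add"
  assumes "a \<le> b"
  shows "(\<Sum>y\<in>{a..<b}. f (y + 1) - f y) = f b - f a"
  using assms
proof (induction b rule: int_ge_induct)
  case (step b)
  have "{a..<b + 1} = insert b {a..<b}" using step by auto
  thus ?case using step by simp
qed simp

text \<open>Multiplying the sum by \<open>ecis t - 1\<close> telescopes it to a difference of two
  unit vectors. The product form also covers integral t, where a quotient would not make
  sense.\<close>

lemma norm_geometric_ecis:
  fixes a b :: int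
  shows "norm (\<Sum>y\<in>{a..<b}. ecis (t * of_int y + c)) * nid t \<le> 2"
proof (cases "a \<le> b")
  case True
  let ?S = "\<Sum>y\<in>{a..<b}. ecis (t * of_int y + c)"
  have "(ecis t - 1) * ?S = (\<Sum>y\<in>{a..<b}. ecis (t * of_int (y + 1) + c) - ecis (t * of_int y + c))"
    unfolding sum_distrib_left by (intro sum.cong) (simp_all add: algebra_simps flip: ecis_add)
  also have "\<dots> = ecis (t * of_int b + c) - ecis (t * of_int a + c)"
    by (rule sum_int_telescope[OF True])
  finally have "norm (ecis t - 1) * norm ?S = norm (ecis (t * of_int b + c) - ecis (t * of_int a + c))"
    by (metis norm_mult)
  also have "\<dots> \<le> 2" using norm_triangle_ineq4[of "ecis (t * of_int b + c)" "ecis (t * of_int a + c)"] by simp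
  finally have "norm (ecis t - 1) * norm ?S \<le> 2" .
  moreover have "norm ?S * nid t \<le> norm ?S * norm (ecis t - 1)"
    by (intro mult_left_mono nid_le_norm_ecis) auto
  ultimately show ?thesis by (simp add: mult.commute)
qed auto

section \<open>Integers at which a linear form is close to an integer\<close>

lemma card_ints_le:
  fixes S :: "int set"
  assumes "\<And>x y. x \<in> S \<Longrightarrow> y \<in> S \<Longrightarrow> real_of_int (x - y) \<le> B" "B \<ge> 0"
  shows "finite S" "real (card S) \<le> B + 1"
proof -
  have *: "finite S \<and> real (card S) \<le> B + 1"
  proof (cases "S = {}")
    case False
    then obtain s where s: "s \<in> S" by blast
    have fin: "finite S"
    proof (rule finite_subset)
      show "S \<subseteq> {s - \<lfloor>B\<rfloor>..s + \<lfloor>B\<rfloor>}"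
      proof
        fix x assume "x \<in> S"
        with assms(1)[of x s] assms(1)[of s x] s have "x - s \<le> \<lfloor>B\<rfloor>" "s - x \<le> \<lfloor>B\<rfloor>"
          by (simp_all add: le_floor_iff)
        thus "x \<in> {s - \<lfloor>B\<rfloor>..s + \<lfloor>B\<rfloor>}" by auto
      qed
    qed auto
    have "S \<subseteq> {Min S..Max S}" using fin by auto
    hence "card S \<le> card {Min S..Max S}" by (intro card_mono) auto
    also have "\<dots> = nat (Max S - Min S + 1)" by simp
    finally have "real (card S) \<le> real_of_int (Max S - Min S) + 1"
      using Min_le[OF fin s] Max_ge[OF fin s] by linarith
    also have "real_of_int (Max S - Min S) \<le> B"
      using fin False by (intro assms) auto
    finally show ?thesis using fin by simp
  qed (use assms in auto)
  show "finite S" "real (card S) \<le> B + 1" using * by auto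
qed

text \<open>Sort S by the integer nearest to c + t z. The values spread over a length |t| Z, which
  leaves |t| Z + 2 candidates for that integer; those z sharing one candidate lie within 2 e / |t|
  of each other.\<close>

lemma card_near_ints:
  assumes "t \<noteq> 0" "e \<ge> 0" "Z \<ge> 0"
  assumes S: "\<And>z. z \<in> S \<Longrightarrow> nid (c + t * of_int z) \<le> e"
  assumes diam: "\<And>x y. x \<in> S \<Longrightarrow> y \<in> S \<Longrightarrow> real_of_int (x - y) \<le> Z"
  shows "real (card S) \<le> (2 * e / \<bar>t\<bar> + 1) * (\<bar>t\<bar> * Z + 2)"
proof -
  define r where "r = (\<lambda>z. round (c + t * real_of_int z))"
  have finS: "finite S" using card_ints_le(1)[OF diam assms(3)] .
  have rd: "\<bar>(c + t * real_of_int z) - of_int (r z)\<bar> \<le> 1 / 2" for z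
    using nid_le_half[of "c + t * real_of_int z"] by (simp add: nid_def r_def)
  have tz: "\<bar>t * of_int x - t * of_int y\<bar> \<le> \<bar>t\<bar> * Z" if "x \<in> S" "y \<in> S" for x y
  proof -
    have "\<bar>t * of_int x - t * of_int y\<bar> = \<bar>t\<bar> * \<bar>real_of_int (x - y)\<bar>"
      by (simp add: abs_mult flip: right_diff_distrib)
    also have "\<dots> \<le> \<bar>t\<bar> * Z"
      using diam[of x y] diam[of y x] that by (intro mult_left_mono) auto
    finally show ?thesis .
  qed
  have im: "real (card (r ` S)) \<le> (\<bar>t\<bar> * Z + 1) + 1"
  proof (rule card_ints_le(2))
    fix u v assume "u \<in> r ` S" "v \<in> r ` S"
    then obtain x y where xy: "x \<in> S" "y \<in> S" "u = r x" "v = r y" by auto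
    show "real_of_int (u - v) \<le> \<bar>t\<bar> * Z + 1"
      using rd[of x] rd[of y] tz[OF xy(1,2)] unfolding xy(3,4) of_int_diff by linarith
  qed (use assms in auto)
  have fib: "real (card {z \<in> S. r z = m}) \<le> 2 * e / \<bar>t\<bar> + 1" for m
  proof (rule card_ints_le(2))
    fix x y assume xy: "x \<in> {z \<in> S. r z = m}" "y \<in> {z \<in> S. r z = m}"
    have "\<bar>c + t * real_of_int x - m\<bar> \<le> e" "\<bar>c + t * real_of_int y - m\<bar> \<le> e"
      using S[of x] S[of y] xy by (auto simp: nid_def r_def)
    hence "\<bar>t * of_int x - t * of_int y\<bar> \<le> 2 * e" by linarith
    hence "\<bar>t\<bar> * \<bar>real_of_int (x - y)\<bar> \<le> 2 * e"
      by (simp add: abs_mult flip: right_diff_distrib)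
    hence "\<bar>real_of_int (x - y)\<bar> \<le> 2 * e / \<bar>t\<bar>"
      using assms(1) by (simp add: field_simps)
    thus "real_of_int (x - y) \<le> 2 * e / \<bar>t\<bar>" by linarith
  qed (use assms in auto)
  have "S = (\<Union>m\<in>r ` S. {z \<in> S. r z = m})" by auto
  hence "card S \<le> (\<Sum>m\<in>r ` S. card {z \<in> S. r z = m})"
    using card_UN_le[of "r ` S" "\<lambda>m. {z \<in> S. r z = m}"] finS by simp
  hence "real (card S) \<le> (\<Sum>m\<in>r ` S. real (card {z \<in> S. r z = m}))"
    by (metis of_nat_le_iff of_nat_sum)
  also have "\<dots> \<le> (\<Sum>m\<in>r ` S. 2 * e / \<bar>t\<bar> + 1)"
    by (intro sum_mono fib)
  also have "\<dots> = (2 * e / \<bar>t\<bar> + 1) * real (card (r ` S))" by simp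
  also have "\<dots> \<le> (2 * e / \<bar>t\<bar> + 1) * (\<bar>t\<bar> * Z + 2)"
    using im assms(2) by (intro mult_left_mono) auto
  finally show ?thesis .
qed

text \<open>Here \<open>q\<close> is a small gap of \<open>H\<close>, so \<open>\<parallel>qt\<parallel> \<le> 2e\<close>. Along each residue class modulo \<open>q\<close> the
  sequence \<open>ht\<close> moves in steps of that size, and \<open>H\<close> could not be as large as it is unless the
  steps were much smaller still.\<close>

lemma vinogradov:
  fixes N :: nat and H :: "int set"
  assumes H: "H \<subseteq> {- int N<..<int N}" "\<And>h. h \<in> H \<Longrightarrow> nid (t * of_int h) \<le> e"
    and card: "real N / L \<le> real (card H)"
    and "L \<ge> 1" "4 * L \<le> real N" "16 * L * e \<le> 1" "0 \<le> e"
  shows "\<exists>q::nat. 1 \<le> q \<and> real q \<le> 5 * L \<and> nid (real q * t) \<le> 80 * L\<^sup>2 * e / real N"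
proof -
  \<comment> \<open>Block length for a pigeonhole: the 2N - 1 integers around 0 meet fewer blocks of
    length B than the N / L elements that H has, so two elements of H share a block and differ by
    less than B.\<close>
  define B where "B = \<lceil>4 * L\<rceil>"
  have B: "4 * L \<le> B" "B \<le> 5 * L" "B > 0" using \<open>L \<ge> 1\<close> by (auto simp: B_def; linarith)+
  have finH: "finite H" using H(1) by (rule finite_subset) auto
  have "\<not> inj_on (\<lambda>h. h div B) H"
  proof
    assume inj: "inj_on (\<lambda>h. h div B) H"
    have "real (card ((\<lambda>h. h div B) ` H)) \<le> ((2 * real N - 2) / B + 1) + 1"
    proof (rule card_ints_le(2))
      fix u v assume "u \<in> (\<lambda>h. h div B) ` H" "v \<in> (\<lambda>h. h div B) ` H"
      then obtain x y where xy: "x \<in> H" "y \<in> H" "u = x div B" "v = y div B" by auto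
      have "B * u \<le> x" "y < B * v + B"
        using B(3) unfolding xy(3,4)
        by (smt (verit) mult_div_mod_eq pos_mod_sign pos_mod_bound)+
      moreover have "x - y \<le> 2 * int N - 2" using subsetD[OF H(1) xy(1)] subsetD[OF H(1) xy(2)] by simp
      ultimately have "B * (u - v) \<le> 2 * int N - 2 + B" by (simp add: algebra_simps)
      hence "of_int (B * (u - v)) \<le> (of_int (2 * int N - 2 + B) :: real)"
        by (simp only: of_int_le_iff)
      thus "real_of_int (u - v) \<le> (2 * real N - 2) / B + 1"
        using B(3) by (simp add: field_simps)
    qed (use B \<open>4 * L \<le> real N\<close> \<open>L \<ge> 1\<close> in auto)
    also have "real (card ((\<lambda>h. h div B) ` H)) = real (card H)"
      using inj by (simp add: card_image)
    also have "(2 * real N - 2) / B \<le> (2 * real N - 2) / (4 * L)"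
      using B \<open>L \<ge> 1\<close> \<open>4 * L \<le> real N\<close> by (intro divide_left_mono) auto
    finally have "real N / L \<le> (2 * real N - 2) / (4 * L) + 2" using card by simp
    thus False using \<open>L \<ge> 1\<close> \<open>4 * L \<le> real N\<close> by (simp add: field_simps)
  qed
  then obtain x y where xy: "x \<in> H" "y \<in> H" "y < x" "x div B = y div B"
    unfolding inj_on_def by (metis linorder_neqE)
  define q where "q = x - y"
  have q0: "q > 0" using xy by (simp add: q_def)
  have "q < B"
  proof -
    have "x = B * (x div B) + x mod B" "y = B * (x div B) + y mod B"
      by (simp, simp add: xy(4))
    moreover have "x mod B < B" "y mod B \<ge> 0" using B(3) by simp_all
    ultimately show ?thesis unfolding q_def by linarith
  qed
  hence q5: "real_of_int q \<le> 5 * L" using B by linarith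
  obtain m where m: "nid (of_int q * t) = \<bar>of_int q * t - of_int m\<bar>" by (rule nidE)
  define d where "d = of_int q * t - of_int m"
  have "nid (of_int q * t) \<le> e + e"
    using nid_diff_le[of "t * x" "t * y"] H(2)[OF xy(1)] H(2)[OF xy(2)]
    by (simp add: q_def algebra_simps)
  hence d2: "\<bar>d\<bar> \<le> 2 * e" using m by (simp add: d_def)
  have "\<bar>d\<bar> \<le> 80 * L\<^sup>2 * e / real N"
  proof (cases "d = 0")
    case False
    \<comment> \<open>Since q t = d + m, along h = q z + r the value t h moves modulo 1 in steps of
      d. So \<open>card_near_ints\<close> applies to the quotients z, which spread over at most 2N /
      q.\<close>
    have Hr: "real (card {h \<in> H. h mod q = r}) \<le> (2 * e / \<bar>d\<bar> + 1) * (\<bar>d\<bar> * (2 * real N / q) + 2)" for r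
    proof -
      let ?f = "\<lambda>h. h div q" and ?H = "{h \<in> H. h mod q = r}"
      have dec: "h = q * (h div q) + r" if "h \<in> ?H" for h
        using that by (metis (mono_tags, lifting) mem_Collect_eq mult_div_mod_eq)
      have "inj_on ?f ?H"
      proof (rule inj_onI)
        fix x y assume "x \<in> ?H" "y \<in> ?H" "x div q = y div q"
        thus "x = y" using dec[of x] dec[of y] by simp
      qed
      hence "card ?H = card (?f ` ?H)" by (simp add: card_image)
      also have "real (card (?f ` ?H)) \<le> (2 * e / \<bar>d\<bar> + 1) * (\<bar>d\<bar> * (2 * real N / q) + 2)"
      proof (rule card_near_ints[where c = "t * r"])
        fix z assume "z \<in> ?f ` ?H"
        then obtain h where h: "h \<in> ?H" "z = h div q" by auto
        have "real_of_int h = q * z + r" using dec[OF h(1)] h(2) by (metis of_int_add of_int_mult)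
        hence "t * of_int h = t * r + d * z + of_int (m * z)"
          by (simp add: d_def algebra_simps)
        hence "nid (t * r + d * z) = nid (t * of_int h)" by (simp only: nid_add_int)
        thus "nid (t * r + d * z) \<le> e" using H(2)[of h] h by simp
      next
        fix u v assume "u \<in> ?f ` ?H" "v \<in> ?f ` ?H"
        then obtain x y where xy: "x \<in> ?H" "y \<in> ?H" "u = x div q" "v = y div q" by auto
        have "q * (u - v) = x - y" using dec[OF xy(1)] dec[OF xy(2)] xy(3,4) by (simp add: algebra_simps)
        also have "x - y \<le> 2 * int N" using xy(1,2) subsetD[OF H(1), of x] subsetD[OF H(1), of y] by simp
        finally have "of_int (q * (u - v)) \<le> (of_int (2 * int N) :: real)"
          by (simp only: of_int_le_iff)
        thus "real_of_int (u - v) \<le> 2 * real N / q" using q0 by (simp add: field_simps)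
      qed (use False \<open>0 \<le> e\<close> q0 in auto)
      finally show ?thesis .
    qed
    define D where "D = \<bar>d\<bar>"
    have D: "D > 0" "D \<le> 2 * e" using False d2 by (auto simp: D_def)
    have "H = (\<Union>r\<in>{0..<q}. {h \<in> H. h mod q = r})" using q0 by auto
    hence "card H \<le> (\<Sum>r\<in>{0..<q}. card {h \<in> H. h mod q = r})"
      using card_UN_le[of "{0..<q}" "\<lambda>r. {h \<in> H. h mod q = r}"] by simp
    hence "real (card H) \<le> (\<Sum>r\<in>{0..<q}. real (card {h \<in> H. h mod q = r}))"
      by (metis of_nat_le_iff of_nat_sum)
    also have "\<dots> \<le> (\<Sum>r\<in>{0..<q}. (2 * e / D + 1) * (D * (2 * real N / q) + 2))"
      unfolding D_def by (intro sum_mono Hr)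
    also have "\<dots> = (2 * e / D + 1) * (2 * D * real N + 2 * q)"
      using q0 by (simp add: field_simps)
    \<comment> \<open>\<open>D \<le> 2 * e\<close> makes 1 at most 2 e / D.\<close>
    also have "\<dots> \<le> (4 * e / D) * (2 * D * real N + 2 * q)"
      using D q0 by (intro mult_right_mono) (auto simp: field_simps)
    also have "\<dots> = 8 * e * real N + 8 * e * q / D"
      using D by (simp add: field_simps)
    finally have "real N / L \<le> 8 * e * real N + 8 * e * q / D" using card by simp
    \<comment> \<open>By 16 L e \<le> 1 this term is at most half of N / L and is absorbed on the
      left, which leaves an upper bound for D.\<close>
    moreover have "8 * e * real N \<le> real N / (2 * L)"
      using mult_right_mono[OF \<open>16 * L * e \<le> 1\<close>, of "real N"] \<open>L \<ge> 1\<close> by (simp add: field_simps)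
    ultimately have "real N / L - real N / (2 * L) \<le> 8 * e * q / D" by linarith
    hence "real N / (2 * L) \<le> 8 * e * q / D" using \<open>L \<ge> 1\<close> by (simp add: field_simps)
    hence "D * real N \<le> 16 * L * e * q"
      using D \<open>L \<ge> 1\<close> by (simp add: field_simps)
    also have "\<dots> \<le> 16 * L * e * (5 * L)"
      using q5 \<open>L \<ge> 1\<close> \<open>0 \<le> e\<close> by (intro mult_left_mono) auto
    finally show ?thesis
      unfolding D_def[symmetric] using \<open>L \<ge> 1\<close> \<open>4 * L \<le> real N\<close> by (simp add: field_simps power2_eq_square)
  qed (use \<open>0 \<le> e\<close> in auto)
  hence "nid (of_int q * t) \<le> 80 * L\<^sup>2 * e / real N"
    using m by (simp add: d_def)
  thus ?thesis
    using q0 q5 by (intro exI[of _ "nat q"]) auto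
qed

section \<open>Weyl differencing\<close>

text \<open>\<open>diff_lead k \<beta> F\<close> holds of a polynomial \<open>F\<close> of degree at most \<open>k + 1\<close>, and then
  \<open>\<beta>\<close> is \<open>(k + 1)!\<close> times its coefficient of degree \<open>k + 1\<close>. These iterated differences are all that
  Weyl differencing needs to know about \<open>F\<close>.\<close>

primrec diff_lead :: "nat \<Rightarrow> real \<Rightarrow> (int \<Rightarrow> real) \<Rightarrow> bool" where
  "diff_lead 0 \<beta> F = (\<exists>c. \<forall>y. F y = \<beta> * of_int y + c)"
| "diff_lead (Suc k) \<beta> F = (\<forall>h. diff_lead k (\<beta> * of_int h) (\<lambda>y. F (y + h) - F y))"

lemma poly_degree_le_1:
  fixes p :: "real poly"
  assumes "degree p \<le> Suc 0"
  shows "poly p x = coeff p (Suc 0) * x + coeff p 0"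
  using arg_cong[OF poly_as_sum_of_monoms'[OF assms], of "\<lambda>p. poly p x"]
  by (simp add: poly_monom)

text \<open>The leading monomial is differenced by the binomial theorem and alone determines the top
  coefficient of the difference. The rest of p has smaller degree, so by induction its difference
  has too small a degree to matter there.\<close>

lemma poly_difference:
  fixes p :: "real poly"
  assumes "degree p \<le> Suc k"
  shows "\<exists>r. degree r \<le> k \<and> coeff r k = real (Suc k) * h * coeff p (Suc k) \<and>
           (\<forall>y. poly r y = poly p (y + h) - poly p y)"
  using assms
proof (induction k arbitrary: p)
  case 0
  show ?case
    by (intro exI[of _ "[:h * coeff p 1:]"]) (auto simp: poly_degree_le_1[OF 0] algebra_simps)
next
  case (Suc k)
  define c where "c = coeff p (Suc (Suc k))"
  define p' where "p' = p - monom c (Suc (Suc k))"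
  have "degree p' \<le> Suc k"
  proof (rule degree_le, intro allI impI)
    fix i assume "i > Suc k"
    thus "coeff p' i = 0" using Suc.prems
      by (cases "i = Suc (Suc k)") (auto simp: p'_def c_def coeff_eq_0)
  qed
  from Suc.IH[OF this] obtain r where r: "degree r \<le> k" "\<And>y. poly r y = poly p' (y + h) - poly p' y"
    by blast
  define s where "s = (\<Sum>i\<le>Suc k. monom (c * real (Suc (Suc k) choose i) * h ^ (Suc (Suc k) - i)) i)"
  have s: "poly s y = c * (y + h) ^ Suc (Suc k) - c * y ^ Suc (Suc k)" for y
  proof -
    have "(y + h) ^ Suc (Suc k) = (\<Sum>i\<le>Suc (Suc k). real (Suc (Suc k) choose i) * y ^ i * h ^ (Suc (Suc k) - i))"
      by (rule binomial_ring)
    also have "\<dots> = (\<Sum>i\<le>Suc k. real (Suc (Suc k) choose i) * y ^ i * h ^ (Suc (Suc k) - i)) + y ^ Suc (Suc k)"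
      by (subst sum.atMost_Suc) simp
    finally have "c * (y + h) ^ Suc (Suc k) - c * y ^ Suc (Suc k) =
        (\<Sum>i\<le>Suc k. c * (real (Suc (Suc k) choose i) * y ^ i * h ^ (Suc (Suc k) - i)))"
      by (simp add: sum_distrib_left algebra_simps)
    thus ?thesis unfolding s_def poly_sum poly_monom by (simp add: mult_ac)
  qed
  have degs: "degree s \<le> Suc k" unfolding s_def
    by (intro degree_sum_le) (auto intro: order_trans[OF degree_monom_le])
  have cs: "coeff s (Suc k) = c * real (Suc (Suc k)) * h"
    unfolding s_def coeff_sum by (simp add: if_distrib[of "\<lambda>x. _ * x"] sum.delta)
  show ?case
  proof (intro exI[of _ "r + s"] conjI allI)
    show "degree (r + s) \<le> Suc k" using r(1) degs by (intro degree_add_le) auto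
    show "coeff (r + s) (Suc k) = real (Suc (Suc k)) * h * coeff p (Suc (Suc k))"
      using r(1) cs by (simp add: coeff_eq_0 c_def)
    show "poly (r + s) y = poly p (y + h) - poly p y" for y
      by (simp add: r(2) s p'_def poly_monom)
  qed
qed

lemma diff_lead_poly:
  fixes p :: "real poly"
  assumes "degree p \<le> Suc k"
  shows "diff_lead k (fact (Suc k) * coeff p (Suc k)) (\<lambda>y. poly p (of_int y))"
  using assms
proof (induction k arbitrary: p)
  case 0
  show ?case by (auto simp: poly_degree_le_1[OF 0])
next
  case (Suc k)
  show ?case unfolding diff_lead.simps
  proof
    fix h :: int
    obtain r where r: "degree r \<le> Suc k" "coeff r (Suc k) = real (Suc (Suc k)) * h * coeff p (Suc (Suc k))"
        "\<And>y. poly r y = poly p (y + h) - poly p y"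
      using poly_difference[OF Suc.prems, of "of_int h"] by blast
    show "diff_lead k (fact (Suc (Suc k)) * coeff p (Suc (Suc k)) * of_int h)
        (\<lambda>y. poly p (of_int (y + h)) - poly p (of_int y))"
      using Suc.IH[OF r(1)] by (simp add: r mult_ac)
  qed
qed

section \<open>Weyl's inequality in inverse form\<close>

text \<open>The square is a double sum over y and z, and substituting z = y + h groups it by the
  shift h. For each h the admissible y again form an interval, which is what lets the differencing
  be iterated.\<close>

lemma sum_norm_square_le:
  fixes F :: "int \<Rightarrow> real"
  assumes "b - a \<le> int N"
  shows "(norm (\<Sum>y\<in>{a..<b}. ecis (F y)))\<^sup>2 \<le>
    (\<Sum>h\<in>{- int N<..<int N}. norm (\<Sum>y\<in>{max a (a - h)..<min b (b - h)}. ecis (F (y + h) - F y)))"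
proof -
  let ?S = "\<Sum>y\<in>{a..<b}. ecis (F y)" and ?H = "{- int N<..<int N}"
  have "of_real ((norm ?S)\<^sup>2) = cnj ?S * ?S"
    by (metis complex_norm_square mult.commute)
  also have "\<dots> = (\<Sum>y\<in>{a..<b}. \<Sum>z\<in>{a..<b}. ecis (F z - F y))"
    by (simp add: sum_product cnj_ecis flip: ecis_add)
  also have "\<dots> = (\<Sum>y\<in>{a..<b}. \<Sum>h\<in>{h \<in> ?H. y + h \<in> {a..<b}}. ecis (F (y + h) - F y))"
  proof (rule sum.cong[OF refl])
    fix y assume y: "y \<in> {a..<b}"
    show "(\<Sum>z\<in>{a..<b}. ecis (F z - F y)) = (\<Sum>h\<in>{h \<in> ?H. y + h \<in> {a..<b}}. ecis (F (y + h) - F y))"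
      by (rule sum.reindex_bij_witness[of _ "\<lambda>h. y + h" "\<lambda>z. z - y"]) (use y assms in auto)
  qed
  also have "\<dots> = (\<Sum>h\<in>?H. \<Sum>y\<in>{y \<in> {a..<b}. y + h \<in> {a..<b}}. ecis (F (y + h) - F y))"
    by (rule sum.swap_restrict) auto
  also have "\<dots> = (\<Sum>h\<in>?H. \<Sum>y\<in>{max a (a - h)..<min b (b - h)}. ecis (F (y + h) - F y))"
    by (intro sum.cong refl) auto
  finally have "(norm ?S)\<^sup>2 = norm (\<Sum>h\<in>?H. \<Sum>y\<in>{max a (a - h)..<min b (b - h)}. ecis (F (y + h) - F y))"
    by (metis norm_of_real abs_power2 of_real_power)
  thus ?thesis by (simp add: norm_sum)
qed

text \<open>A threshold of c accounts for at most \<open>card A * c\<close> of the sum, so the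
  surplus \<open>B * s\<close> must come from large values, each adding at most B.\<close>

lemma card_large_values:
  fixes f :: "'a \<Rightarrow> real" and B c s :: real
  assumes "finite A" "\<And>x. x \<in> A \<Longrightarrow> f x \<le> B" "B > 0" "card A * c + B * s \<le> sum f A" "c \<ge> 0"
  shows "s \<le> card {x \<in> A. c \<le> f x}"
proof -
  have "sum f A \<le> (\<Sum>x\<in>A. c + (if c \<le> f x then B else 0))"
    using assms by (intro sum_mono) (auto intro: add_increasing)
  also have "\<dots> = card A * c + B * card {x \<in> A. c \<le> f x}"
    using assms(1) by (simp add: sum.distrib flip: sum.inter_filter)
  finally have "B * s \<le> B * card {x \<in> A. c \<le> f x}" using assms(4) by linarith
  thus ?thesis using assms(3) by simp
qed

text \<open>Pigeonhole: q takes at most B values on A, so its level sets cannot all be smaller than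
  average.\<close>

lemma popular_value:
  fixes q :: "'a \<Rightarrow> nat"
  assumes "finite A" "A \<noteq> {}" "\<And>x. x \<in> A \<Longrightarrow> 1 \<le> q x" "\<And>x. x \<in> A \<Longrightarrow> real (q x) \<le> B"
  shows "\<exists>v\<ge>1. real v \<le> B \<and> card A / B \<le> card {x \<in> A. q x = v}"
proof (rule ccontr)
  assume neg: "\<not> ?thesis"
  obtain x0 where x0: "x0 \<in> A" using assms by blast
  have B: "B \<ge> 1" using assms(3,4)[OF x0] by linarith
  let ?V = "q ` A"
  have V: "?V \<subseteq> {1..nat \<lfloor>B\<rfloor>}" using assms by (auto simp: le_nat_floor)
  have "real (card ?V) \<le> B"
    using card_mono[OF _ V] B by (simp add: le_nat_floor) linarith
  have "card A = (\<Sum>v\<in>?V. card {x \<in> A. q x = v})"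
    using sum.group[of A ?V q "\<lambda>_. 1::nat"] assms(1) by simp
  hence "real (card A) = (\<Sum>v\<in>?V. real (card {x \<in> A. q x = v}))" by simp
  also have "\<dots> < (\<Sum>v\<in>?V. card A / B)"
  proof (rule sum_strict_mono)
    fix v assume "v \<in> ?V"
    hence "v \<ge> 1" "real v \<le> B" using assms by auto
    thus "real (card {x \<in> A. q x = v}) < card A / B" using neg by force
  qed (use assms in auto)
  also have "\<dots> = card ?V * (card A / B)" by simp
  also have "\<dots> \<le> B * (card A / B)" using \<open>real (card ?V) \<le> B\<close> B by (intro mult_right_mono) auto
  finally show False using B by simp
qed

text \<open>If the sum is large, then so are many differenced sums. By induction each of these
  yields a denominator for \<beta> h; one denominator v is shared by many shifts h, and
  \<open>vinogradov\<close> turns these many h into a single approximation of v \<beta>. The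
  exponent K depends on k alone, and \<open>2 \<le> M\<close> lets numerical constants pass into
  powers of M.\<close>

lemma weyl:
  "\<exists>K::nat. \<forall>M::real. \<forall>N::nat. \<forall>a b \<beta> F. 2 \<le> M \<longrightarrow> 1 \<le> N \<longrightarrow> diff_lead k \<beta> F \<longrightarrow> b - a \<le> int N \<longrightarrow>
     real N / M \<le> norm (\<Sum>y\<in>{a..<b}. ecis (F y)) \<longrightarrow>
     (\<exists>q::nat. 1 \<le> q \<and> real q \<le> M ^ K \<and> nid (real q * \<beta>) \<le> M ^ K / real N ^ Suc k)"
proof (induction k)
  case 0
  show ?case
  proof (rule exI[of _ 2], intro allI impI)
    fix M :: real and N :: nat and a b \<beta> F
    assume M: "2 \<le> M" and N: "1 \<le> N" and F: "diff_lead 0 \<beta> F"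
      and S: "real N / M \<le> norm (\<Sum>y\<in>{a..<b}. ecis (F y))"
    obtain c where "\<And>y. F y = \<beta> * of_int y + c" using F by auto
    hence "norm (\<Sum>y\<in>{a..<b}. ecis (F y)) * nid \<beta> \<le> 2"
      using norm_geometric_ecis[of \<beta> c a b] by simp
    hence "real N / M * nid \<beta> \<le> 2"
      using mult_right_mono[OF S nid_nonneg[of \<beta>]] by linarith
    hence "nid \<beta> \<le> M * 2 / real N" using M N by (simp add: field_simps)
    also have "\<dots> \<le> M * M / real N" using M N by (intro divide_right_mono mult_left_mono) auto
    finally have "nid (real 1 * \<beta>) \<le> M\<^sup>2 / real N ^ Suc 0"
      by (simp add: power2_eq_square)
    moreover have "1 * 1 \<le> M * M" using M by (intro mult_mono) auto
    ultimately show "\<exists>q::nat. 1 \<le> q \<and> real q \<le> M\<^sup>2 \<and> nid (real q * \<beta>) \<le> M\<^sup>2 / real N ^ Suc 0"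
      by (intro exI[of _ 1]) (simp add: power2_eq_square)
  qed
next
  case (Suc k)
  then obtain K where K: "\<And>M N a b \<beta> F. 2 \<le> M \<Longrightarrow> 1 \<le> N \<Longrightarrow> diff_lead k \<beta> F \<Longrightarrow> b - a \<le> int N \<Longrightarrow>
     real N / M \<le> norm (\<Sum>y\<in>{a..<b}. ecis (F y)) \<Longrightarrow>
     (\<exists>q::nat. 1 \<le> q \<and> real q \<le> M ^ K \<and> nid (real q * \<beta>) \<le> M ^ K / real N ^ Suc k)"
    by metis
  \<comment> \<open>\<open>M ^ T\<close> bounds N whenever the hypotheses of
    \<open>vinogradov\<close> fail; \<open>K'\<close> is large enough for the exponents arising in
    both cases.\<close>
  define T where "T = 7 + 8 * K"
  define K' where "K' = 13 + 12 * K + T * Suc (Suc k)"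
  show ?case
  proof (rule exI[of _ K'], intro allI impI)
    fix M :: real and N :: nat and a b \<beta> F
    assume M: "2 \<le> M" and N: "1 \<le> N" and F: "diff_lead (Suc k) \<beta> F" and ab: "b - a \<le> int N"
      and S: "real N / M \<le> norm (\<Sum>y\<in>{a..<b}. ecis (F y))"
    have pw: "2 ^ i * M ^ j \<le> M ^ l" if "i + j \<le> l" for i j l
    proof -
      have "2 ^ i * M ^ j \<le> M ^ i * M ^ j" using M by (intro mult_right_mono power_mono) auto
      also have "\<dots> = M ^ (i + j)" by (simp add: power_add)
      also have "\<dots> \<le> M ^ l" using M that by (intro power_increasing) auto
      finally show ?thesis .
    qed
    have p1: "M ^ (3 + 4 * K) * M ^ (4 * K) = M ^ (3 + 8 * K)"
      by (simp add: add.commute flip: power_add)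
    have p2: "(M ^ (3 + 4 * K))\<^sup>2 * M ^ (4 * K) = M ^ (6 + 12 * K)"
      by (simp add: add.commute flip: power_add power_mult)
    \<comment> \<open>With the threshold N / M1, the at most 2N shifts below it account for no more
      than half of (N / M)^2, the lower bound for the squared sum.\<close>
    define M1 where "M1 = 4 * M\<^sup>2"
    have M1: "2 \<le> M1" using M power_mono[of 2 M 2] by (simp add: M1_def)
    have M1K: "M1 ^ K \<le> M ^ (4 * K)"
    proof -
      have "M1 \<le> M ^ 4" using pw[of 2 2 4] by (simp add: M1_def)
      hence "M1 ^ K \<le> (M ^ 4) ^ K" using M1 by (intro power_mono) auto
      thus ?thesis by (simp add: power_mult)
    qed
    \<comment> \<open>At least N / (2 M^2) good shifts, shared among at most M1^K denominators,
      leave N / L shifts for the most popular one.\<close>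
    define L where "L = 2 * M\<^sup>2 * M1 ^ K"
    have L1: "L \<ge> 1"
    proof -
      have "1 * 1 * 1 \<le> 2 * M\<^sup>2 * M1 ^ K" using M M1 by (intro mult_mono one_le_power) auto
      thus ?thesis by (simp add: L_def)
    qed
    have L: "L \<le> M ^ (3 + 4 * K)"
    proof -
      have "L \<le> 2 * M\<^sup>2 * M ^ (4 * K)" unfolding L_def using M1K M by (intro mult_left_mono) auto
      also have "\<dots> = 2 ^ 1 * M ^ (2 + 4 * K)" by (simp add: power_add power2_eq_square)
      also have "\<dots> \<le> M ^ (3 + 4 * K)" by (rule pw) simp
      finally show ?thesis .
    qed
    define e where "e = M1 ^ K / real N ^ Suc k"
    have e0: "0 \<le> e" using M1 by (simp add: e_def)
    show "\<exists>q::nat. 1 \<le> q \<and> real q \<le> M ^ K' \<and> nid (real q * \<beta>) \<le> M ^ K' / real N ^ Suc (Suc k)"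
    proof (cases "4 * L \<le> real N \<and> 16 * L * e \<le> 1")
      case False
      \<comment> \<open>Where \<open>vinogradov\<close> does not apply, N is so small that the
        claimed bound is at least 1, and q = 1 will do.\<close>
      have "real N \<le> M ^ T"
      proof (cases "4 * L \<le> real N")
        case False
        hence "real N \<le> 4 * L" by simp
        also have "\<dots> \<le> 4 * M ^ (3 + 4 * K)" using L by simp
        also have "\<dots> = 2 ^ 2 * M ^ (3 + 4 * K)" by simp
        also have "\<dots> \<le> M ^ T" by (rule pw) (simp add: T_def)
        finally show ?thesis .
      next
        case True
        hence "16 * L * e > 1" using False by simp
        hence "real N ^ Suc k \<le> 16 * L * M1 ^ K" using N by (simp add: e_def field_simps)
        moreover have "real N ^ 1 \<le> real N ^ Suc k" using N by (intro power_increasing) auto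
        ultimately have "real N \<le> 16 * L * M1 ^ K" by simp
        also have "\<dots> \<le> 16 * M ^ (3 + 4 * K) * M ^ (4 * K)"
          using L L1 M1 M1K by (intro mult_mono) auto
        also have "\<dots> = 2 ^ 4 * M ^ (3 + 8 * K)" using p1 by simp
        also have "\<dots> \<le> M ^ T" by (rule pw) (simp add: T_def)
        finally show ?thesis .
      qed
      hence "real N ^ Suc (Suc k) \<le> (M ^ T) ^ Suc (Suc k)" by (intro power_mono) auto
      also have "\<dots> = M ^ (T * Suc (Suc k))" by (simp only: power_mult)
      also have "\<dots> \<le> M ^ K'" using M by (intro power_increasing) (auto simp: K'_def)
      finally have "1 \<le> M ^ K' / real N ^ Suc (Suc k)" using N by (subst le_divide_eq) auto
      hence "nid (real 1 * \<beta>) \<le> M ^ K' / real N ^ Suc (Suc k)"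
        using nid_le_half[of "real 1 * \<beta>"] by linarith
      moreover have "real 1 \<le> M ^ K'" using M by simp
      ultimately show ?thesis by blast
    next
      case True
      define s where "s = (\<lambda>h. norm (\<Sum>y\<in>{max a (a - h)..<min b (b - h)}. ecis (F (y + h) - F y)))"
      let ?A = "{- int N<..<int N}"
      define H where "H = {h \<in> ?A. real N / M1 \<le> s h}"
      have cardA: "real (card ?A) \<le> 2 * real N" by simp
      have "real N / (2 * M\<^sup>2) \<le> card H"
        unfolding H_def
      proof (rule card_large_values[where B = "real N"])
        fix h assume h: "h \<in> ?A"
        have "s h \<le> (\<Sum>y\<in>{max a (a - h)..<min b (b - h)}. 1)"
          unfolding s_def by (rule order_trans[OF norm_sum]) simp
        also have "\<dots> = real (nat (min b (b - h) - max a (a - h)))" by simp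
        also have "\<dots> \<le> real N" using ab by linarith
        finally show "s h \<le> real N" .
      next
        have "card ?A * (real N / M1) \<le> 2 * real N * (real N / M1)"
          using cardA M1 by (intro mult_right_mono) auto
        also have "\<dots> + real N * (real N / (2 * M\<^sup>2)) = (real N / M)\<^sup>2"
          by (simp add: M1_def field_simps power2_eq_square)
        also have "\<dots> \<le> (norm (\<Sum>y\<in>{a..<b}. ecis (F y)))\<^sup>2"
          using S M by (intro power_mono) auto
        also have "\<dots> \<le> sum s ?A" unfolding s_def by (rule sum_norm_square_le[OF ab])
        finally show "card ?A * (real N / M1) + real N * (real N / (2 * M\<^sup>2)) \<le> sum s ?A" by simp
      qed (use N M1 in auto)
      moreover have "real N / (2 * M\<^sup>2) > 0" using N M by simp
      ultimately have H: "real N / (2 * M\<^sup>2) \<le> card H" "H \<noteq> {}" by auto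
      have "\<forall>h\<in>H. \<exists>q::nat. 1 \<le> q \<and> real q \<le> M1 ^ K \<and> nid (real q * (\<beta> * h)) \<le> e"
      proof
        fix h assume h: "h \<in> H"
        show "\<exists>q::nat. 1 \<le> q \<and> real q \<le> M1 ^ K \<and> nid (real q * (\<beta> * h)) \<le> e"
          unfolding e_def
        proof (rule K[OF M1 N])
          show "diff_lead k (\<beta> * real_of_int h) (\<lambda>y. F (y + h) - F y)" using F by simp
          show "min b (b - h) - max a (a - h) \<le> int N" using ab by linarith
          show "real N / M1 \<le> cmod (\<Sum>y = max a (a - h)..<min b (b - h). ecis (F (y + h) - F y))"
            using h by (simp add: H_def s_def)
        qed
      qed
      then obtain q where q: "\<And>h. h \<in> H \<Longrightarrow> 1 \<le> q h" "\<And>h. h \<in> H \<Longrightarrow> real (q h) \<le> M1 ^ K"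
          "\<And>h. h \<in> H \<Longrightarrow> nid (real (q h) * (\<beta> * of_int h)) \<le> e" by metis
      have "finite H" unfolding H_def by (rule finite_subset[of _ ?A]) auto
      from popular_value[of H q "M1 ^ K", OF this H(2) q(1,2)] obtain v where v: "v \<ge> 1" "real v \<le> M1 ^ K"
          "card H / M1 ^ K \<le> card {h \<in> H. q h = v}" by blast
      have "\<exists>q'::nat. 1 \<le> q' \<and> real q' \<le> 5 * L \<and> nid (real q' * (v * \<beta>)) \<le> 80 * L\<^sup>2 * e / real N"
      proof (rule vinogradov[where H = "{h \<in> H. q h = v}"])
        show "{h \<in> H. q h = v} \<subseteq> ?A" by (auto simp: H_def)
        have "real N / L = real N / (2 * M\<^sup>2) / M1 ^ K" by (simp add: L_def)
        also have "\<dots> \<le> card H / M1 ^ K" using H(1) M1 by (intro divide_right_mono) auto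
        also have "\<dots> \<le> card {h \<in> H. q h = v}" by (rule v)
        finally show "real N / L \<le> card {h \<in> H. q h = v}" .
        fix h assume h: "h \<in> {h \<in> H. q h = v}"
        thus "nid (real v * \<beta> * of_int h) \<le> e" using q(3)[of h] by (simp add: mult.assoc)
      qed (use True L1 e0 in auto)
      then obtain q' where q': "1 \<le> q'" "real q' \<le> 5 * L" "nid (real q' * (v * \<beta>)) \<le> 80 * L\<^sup>2 * e / real N"
        by blast
      show ?thesis
      proof (intro exI[of _ "q' * v"] conjI)
        show "1 \<le> q' * v" using q' v by simp
        have "real (q' * v) \<le> (5 * L) * M1 ^ K" unfolding of_nat_mult
          using q' v L1 by (intro mult_mono) auto
        also have "\<dots> \<le> (8 * M ^ (3 + 4 * K)) * M ^ (4 * K)"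
          using L L1 M1K M1 by (intro mult_mono) auto
        also have "\<dots> = 2 ^ 3 * M ^ (3 + 8 * K)" using p1 by simp
        also have "\<dots> \<le> M ^ K'" by (rule pw) (simp add: K'_def)
        finally show "real (q' * v) \<le> M ^ K'" .
        have "nid (real (q' * v) * \<beta>) \<le> 80 * L\<^sup>2 * e / real N"
          using q'(3) by (simp add: mult.assoc)
        also have "\<dots> = 80 * L\<^sup>2 * M1 ^ K / real N ^ Suc (Suc k)"
          by (simp add: e_def)
        also have "\<dots> \<le> 128 * (M ^ (3 + 4 * K))\<^sup>2 * M ^ (4 * K) / real N ^ Suc (Suc k)"
          using L L1 M1K M1 by (intro divide_right_mono mult_mono power_mono) auto
        also have "128 * (M ^ (3 + 4 * K))\<^sup>2 * M ^ (4 * K) = 2 ^ 7 * M ^ (6 + 12 * K)"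
          using p2 by simp
        also have "\<dots> / real N ^ Suc (Suc k) \<le> M ^ K' / real N ^ Suc (Suc k)"
          by (intro divide_right_mono pw) (auto simp: K'_def)
        finally show "nid (real (q' * v) * \<beta>) \<le> M ^ K' / real N ^ Suc (Suc k)" .
      qed
    qed
  qed
qed

section \<open>Equidistribution uniform in all but the linear coefficient\<close>

lemma summation_by_parts:
  fixes c g :: "nat \<Rightarrow> complex"
  assumes "a \<le> b"
  shows "(\<Sum>y\<in>{a..<b}. c y * g y) =
    (\<Sum>y\<in>{a..<b}. c y) * g b - (\<Sum>y\<in>{a..<b}. (\<Sum>x\<in>{a..<Suc y}. c x) * (g (Suc y) - g y))"
  using assms
proof (induction b rule: dec_induct)
  case (step b)
  thus ?case by (simp add: algebra_simps)
qed simp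

text \<open>Abel summation with every partial sum replaced by the largest one. Its endpoint v is
  returned, so that a single sum over an interval remains to be estimated.\<close>

lemma norm_sum_mult_le:
  fixes c g :: "nat \<Rightarrow> complex"
  assumes "a \<le> b"
  shows "\<exists>v\<in>{a..b}. norm (\<Sum>y\<in>{a..<b}. c y * g y) \<le>
    norm (\<Sum>y\<in>{a..<v}. c y) * (norm (g b) + (\<Sum>y\<in>{a..<b}. norm (g (Suc y) - g y)))"
proof -
  define s where "s = (\<lambda>v. norm (\<Sum>y\<in>{a..<v}. c y))"
  have "finite (s ` {a..b})" "s ` {a..b} \<noteq> {}" using assms by auto
  then obtain v where v: "v \<in> {a..b}" "\<And>u. u \<in> {a..b} \<Longrightarrow> s u \<le> s v"
    using Max_in[of "s ` {a..b}"] Max_ge[of "s ` {a..b}"] by (metis (no_types, lifting) imageE imageI)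
  have "norm (\<Sum>y\<in>{a..<b}. c y * g y) \<le> norm ((\<Sum>y\<in>{a..<b}. c y) * g b) +
      norm (\<Sum>y\<in>{a..<b}. (\<Sum>x\<in>{a..<Suc y}. c x) * (g (Suc y) - g y))"
    unfolding summation_by_parts[OF assms, of c g] by (rule norm_triangle_ineq4)
  also have "\<dots> \<le> s b * norm (g b) + (\<Sum>y\<in>{a..<b}. s (Suc y) * norm (g (Suc y) - g y))"
    unfolding s_def by (intro add_mono order_trans[OF norm_sum] sum_mono) (simp_all add: norm_mult)
  also have "\<dots> \<le> s v * norm (g b) + (\<Sum>y\<in>{a..<b}. s v * norm (g (Suc y) - g y))"
    using v assms by (intro add_mono mult_right_mono sum_mono) auto
  also have "\<dots> = s v * (norm (g b) + (\<Sum>y\<in>{a..<b}. norm (g (Suc y) - g y)))"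
    by (simp add: sum_distrib_left distrib_left)
  finally show ?thesis using v(1) unfolding s_def by blast
qed

lemma sum_additive_characters:
  fixes q :: nat and m :: int
  assumes "q > 0"
  shows "(\<Sum>s<q. ecis (real s * (of_int m / real q))) = (if int q dvd m then of_nat q else 0)"
proof (cases "int q dvd m")
  case True
  then obtain t where "m = int q * t" by blast
  hence "real s * (of_int m / real q) = of_int (int s * t)" for s
    using assms by simp
  thus ?thesis using True by (simp only: ecis_of_int) simp
next
  case False
  define w where "w = ecis (of_int m / real q)"
  have pow: "ecis (real s * (of_int m / real q)) = w ^ s" for s
    unfolding w_def ecis_def by (simp only: Complex.DeMoivre) (simp add: mult_ac)
  have "w \<noteq> 1"
  proof
    assume "w = 1"
    hence "nid (of_int m / real q) \<le> 0"
      using nid_le_norm_ecis[of "of_int m / real q"] by (simp add: w_def)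
    hence "of_int m / real q = of_int (round (of_int m / real q))" by (simp add: nid_def)
    hence "real_of_int m = of_int (int q * round (of_int m / real q))"
      using assms by (simp add: field_simps)
    hence "m = int q * round (of_int m / real q)" by (simp only: of_int_eq_iff)
    thus False using False by (metis dvd_triv_left)
  qed
  moreover have "w ^ q = 1" using assms by (simp flip: pow)
  ultimately show ?thesis using False unfolding pow by (simp add: geometric_sum)
qed

text \<open>Expand h into the q additive characters modulo q. The Fourier coefficients
  \<open>H s\<close> have norm at most 1, so the triangle inequality loses a factor q against the
  worst character.\<close>

lemma periodic_twist:
  fixes h f :: "nat \<Rightarrow> complex"
  assumes q: "q > 0" and h: "\<And>y. norm (h y) \<le> 1" "\<And>y. h y = h (y mod q)" and "finite I"
  shows "\<exists>s<q. norm (\<Sum>y\<in>I. h y * f y) \<le> real q * norm (\<Sum>y\<in>I. ecis (real s / real q * real y) * f y)"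
proof -
  define H where "H = (\<lambda>s. (\<Sum>r<q. h r * ecis (- (real s * real r / real q))) / of_nat q)"
  have H: "norm (H s) \<le> 1" for s
  proof -
    have "norm (\<Sum>r<q. h r * ecis (- (real s * real r / real q))) \<le> (\<Sum>r<q. 1)"
      using h(1) by (intro order_trans[OF norm_sum] sum_mono) (simp add: norm_mult)
    thus ?thesis using q by (simp add: H_def norm_divide divide_le_eq)
  qed
  have expand: "h y = (\<Sum>s<q. H s * ecis (real s / real q * real y))" for y
  proof -
    have Hs: "H s * ecis (real s / real q * real y) =
        (\<Sum>r<q. h r * ecis (real s * (of_int (int y - int r) / real q))) / of_nat q" for s
      unfolding H_def times_divide_eq_left sum_distrib_right
    proof (intro arg_cong[where f = "\<lambda>x. x / of_nat q"] sum.cong refl)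
      fix r
      have "- (real s * real r / real q) + real s * real y / real q = real s * (of_int (int y - int r) / real q)"
        using q by (simp add: field_simps)
      thus "h r * ecis (- (real s * real r / real q)) * ecis (real s * real y / real q) =
          h r * ecis (real s * (of_int (int y - int r) / real q))"
        by (simp only: mult.assoc flip: ecis_add)
    qed
    have "(\<Sum>s<q. H s * ecis (real s / real q * real y)) =
        (\<Sum>s<q. \<Sum>r<q. h r * ecis (real s * (of_int (int y - int r) / real q))) / of_nat q"
      by (simp only: Hs sum_divide_distrib)
    also have "\<dots> = (\<Sum>r<q. h r * (\<Sum>s<q. ecis (real s * (of_int (int y - int r) / real q)))) / of_nat q"
      by (subst sum.swap) (simp add: sum_distrib_left)
    also have "\<dots> = (\<Sum>r<q. h r * (if r = y mod q then of_nat q else 0)) / of_nat q"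
    proof (intro arg_cong[where f = "\<lambda>x. x / of_nat q"] sum.cong refl arg_cong2[where f = "(*)"])
      fix r assume "r \<in> {..<q}"
      hence "int q dvd int y - int r \<longleftrightarrow> r = y mod q"
        by (metis lessThan_iff mod_eq_dvd_iff mod_less of_nat_eq_iff of_nat_mod)
      thus "(\<Sum>s<q. ecis (real s * (of_int (int y - int r) / real q))) =
          (if r = y mod q then of_nat q else 0)"
        using sum_additive_characters[OF q, of "int y - int r"] by simp
    qed
    also have "\<dots> = h (y mod q)"
      using q by (simp add: if_distrib[of "\<lambda>x. _ * x"] sum.delta cong: if_cong)
    finally show ?thesis using h(2)[of y] by simp
  qed
  define n where "n = (\<lambda>s. norm (\<Sum>y\<in>I. ecis (real s / real q * real y) * f y))"
  have "finite (n ` {..<q})" "n ` {..<q} \<noteq> {}" using q by auto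
  then obtain s where s: "s < q" "\<And>t. t < q \<Longrightarrow> n t \<le> n s"
    using Max_in[of "n ` {..<q}"] Max_ge[of "n ` {..<q}"] by (metis (no_types, lifting) imageE imageI lessThan_iff)
  have "(\<Sum>y\<in>I. h y * f y) = (\<Sum>s<q. H s * (\<Sum>y\<in>I. ecis (real s / real q * real y) * f y))"
    unfolding expand[of _] sum_distrib_right sum_distrib_left
    by (subst sum.swap) (simp add: mult.assoc)
  hence "norm (\<Sum>y\<in>I. h y * f y) \<le> (\<Sum>s<q. norm (H s) * n s)"
    by (simp add: n_def flip: norm_mult) (rule norm_sum)
  also have "\<dots> \<le> (\<Sum>t<q. 1 * n s)"
    using s H by (intro sum_mono mult_mono) (auto simp: n_def)
  also have "\<dots> = real q * n s" by simp
  finally show ?thesis using s(1) unfolding n_def by blast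
qed

text \<open>By \<open>weyl\<close> the leading coefficient is close to some A / q. The leading term
  thus splits into \<open>h\<close>, periodic modulo q, and \<open>g\<close>, whose variation is at
  most a power of M. Partial summation removes \<open>g\<close>, and \<open>h\<close> is traded for
  one character, which moves the linear coefficient by s / q. The degree has dropped and the
  induction hypothesis applies.\<close>

lemma weyl_linear:
  "\<exists>K::nat. \<forall>M::real. \<forall>N a b::nat. \<forall>p :: real poly. 2 \<le> M \<longrightarrow> 1 \<le> N \<longrightarrow> degree p \<le> Suc k \<longrightarrow> 1 \<le> a \<longrightarrow> b \<le> Suc N \<longrightarrow>
     real N / M \<le> norm (\<Sum>y\<in>{a..<b}. ecis (poly p (real y))) \<longrightarrow>
     (\<exists>q::nat. 1 \<le> q \<and> real q \<le> M ^ K \<and> nid (real q * coeff p 1) \<le> M ^ K / real N)"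
proof (induction k)
  case 0
  obtain K where K: "\<And>M N a b \<beta> F. 2 \<le> M \<Longrightarrow> 1 \<le> N \<Longrightarrow> diff_lead 0 \<beta> F \<Longrightarrow> b - a \<le> int N \<Longrightarrow>
     real N / M \<le> norm (\<Sum>y\<in>{a..<b}. ecis (F y)) \<Longrightarrow>
     (\<exists>q::nat. 1 \<le> q \<and> real q \<le> M ^ K \<and> nid (real q * \<beta>) \<le> M ^ K / real N ^ Suc 0)"
    using weyl[of 0] by metis
  show ?case
  proof (rule exI[of _ K], intro allI impI)
    fix M :: real and N a b :: nat and p :: "real poly"
    assume *: "2 \<le> M" "1 \<le> N" "degree p \<le> Suc 0" "1 \<le> a" "b \<le> Suc N"
     "real N / M \<le> norm (\<Sum>y\<in>{a..<b}. ecis (poly p (real y)))"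
    have "real N / M \<le> norm (\<Sum>y\<in>{int a..<int b}. ecis (poly p (of_int y)))"
      using *(6) by (simp add: sum.reindex flip: image_int_atLeastLessThan)
    from K[OF *(1,2) diff_lead_poly[OF *(3)] _ this] *(4,5)
    show "\<exists>q\<ge>1. real q \<le> M ^ K \<and> nid (real q * coeff p 1) \<le> M ^ K / real N" by simp
  qed
next
  case (Suc k)
  define D where "D = Suc (Suc k)"
  obtain K where K: "\<And>M N a b p. 2 \<le> M \<Longrightarrow> 1 \<le> N \<Longrightarrow> degree p \<le> Suc k \<Longrightarrow> 1 \<le> a \<Longrightarrow> b \<le> Suc N \<Longrightarrow>
     real N / M \<le> norm (\<Sum>y\<in>{a..<b}. ecis (poly p (real y))) \<Longrightarrow>
     (\<exists>q::nat. 1 \<le> q \<and> real q \<le> M ^ K \<and> nid (real q * coeff p 1) \<le> M ^ K / real N)"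
    using Suc.IH by metis
  obtain K1 where K1: "\<And>M N a b \<beta> F. 2 \<le> M \<Longrightarrow> 1 \<le> N \<Longrightarrow> diff_lead (Suc k) \<beta> F \<Longrightarrow> b - a \<le> int N \<Longrightarrow>
     real N / M \<le> norm (\<Sum>y\<in>{a..<b}. ecis (F y)) \<Longrightarrow>
     (\<exists>q::nat. 1 \<le> q \<and> real q \<le> M ^ K1 \<and> nid (real q * \<beta>) \<le> M ^ K1 / real N ^ D)"
    using weyl[of "Suc k"] unfolding D_def by metis
  \<comment> \<open>\<open>K2\<close> is the exponent for the variation of \<open>g\<close>,
    \<open>K3\<close> the one for the denominator q, and \<open>E\<close> the total loss: the sum
    for the reduced polynomial \<open>p2\<close> is still at least N / M^E.\<close>
  define K2 where "K2 = K1 + D + 3"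
  define K3 where "K3 = K1 + fact D"
  define E where "E = 1 + K2 + K3"
  show ?case
  proof (rule exI[of _ "E * K + K3"], intro allI impI)
    fix M :: real and N a b :: nat and p :: "real poly"
    assume M: "2 \<le> M" and N: "1 \<le> N" and p: "degree p \<le> Suc (Suc k)" and a: "1 \<le> a" and b: "b \<le> Suc N"
      and S: "real N / M \<le> norm (\<Sum>y\<in>{a..<b}. ecis (poly p (real y)))"
    \<comment> \<open>Partial summation needs this order; otherwise the sum would be empty while its
      lower bound N / M is positive.\<close>
    have ab: "a \<le> b"
    proof (rule ccontr)
      assume "\<not> a \<le> b"
      hence "real N / M \<le> 0" using S by simp
      thus False using M N by (simp add: divide_le_0_iff)
    qed
    define \<beta> where "\<beta> = coeff p D"
    have "real N / M \<le> norm (\<Sum>y\<in>{int a..<int b}. ecis (poly p (of_int y)))"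
      using S by (simp add: sum.reindex flip: image_int_atLeastLessThan)
    from K1[OF M N diff_lead_poly[OF p] _ this] a b obtain q0 where q0: "1 \<le> q0" "real q0 \<le> M ^ K1"
      "nid (real q0 * (fact D * \<beta>)) \<le> M ^ K1 / real N ^ D" unfolding \<beta>_def D_def by auto
    \<comment> \<open>Iterated differencing sees the leading coefficient only multiplied by
      \<open>fact D\<close>, so this factor goes into the denominator.\<close>
    define q where "q = q0 * fact D"
    have q: "q > 0" "real q \<le> M ^ K3"
    proof -
      show "q > 0" using q0 by (simp add: q_def)
      have "real (fact D) \<le> 2 ^ fact D" using less_exp[of "fact D"] by (metis less_imp_le of_nat_le_iff of_nat_numeral of_nat_power)
      also have "\<dots> \<le> M ^ fact D" using M by (intro power_mono) auto
      finally have "real q0 * real (fact D) \<le> M ^ K1 * M ^ fact D"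
        using q0 M by (intro mult_mono) auto
      thus "real q \<le> M ^ K3" by (simp add: q_def K3_def power_add)
    qed
    obtain A where A: "nid (real q * \<beta>) = \<bar>real q * \<beta> - of_int A\<bar>" by (rule nidE)
    define d where "d = real q * \<beta> - of_int A"
    have d: "\<bar>d\<bar> \<le> M ^ K1 / real N ^ D" using q0(3) A by (simp add: d_def q_def mult.assoc)
    define p' where "p' = p - monom \<beta> D"
    have p': "degree p' \<le> Suc k"
    proof (rule degree_le, intro allI impI)
      fix i assume "i > Suc k"
      thus "coeff p' i = 0" using p
        by (cases "i = Suc (Suc k)") (auto simp: p'_def \<beta>_def D_def coeff_eq_0)
    qed
    have cp': "coeff p' 1 = coeff p 1" by (simp add: p'_def D_def)
    define g where "g = (\<lambda>y::nat. ecis (d / real q * real y ^ D))"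
    define h where "h = (\<lambda>y::nat. ecis (of_int A * real y ^ D / real q))"
    have fac: "ecis (poly p (real y)) = (h y * ecis (poly p' (real y))) * g y" for y
    proof -
      have "\<beta> = of_int A / real q + d / real q" using q by (simp add: d_def field_simps)
      hence "poly p (real y) = of_int A * real y ^ D / real q + poly p' (real y) + d / real q * real y ^ D"
        by (simp add: p'_def poly_monom algebra_simps)
      thus ?thesis by (simp only: g_def h_def ecis_add)
    qed
    \<comment> \<open>The powers y^D increase, so the variation telescopes to at most a constant
      times |d| (2N)^D, using b \<le> N + 1 \<le> 2N. The factor N^D cancels against the bound for
      d.\<close>
    have var: "norm (g b) + (\<Sum>y\<in>{a..<b}. norm (g (Suc y) - g y)) \<le> M ^ K2"
    proof -
      have "(\<Sum>y\<in>{a..<b}. norm (g (Suc y) - g y)) \<le>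
          (\<Sum>y\<in>{a..<b}. 2 * pi * (\<bar>d\<bar> / real q) * (real (Suc y) ^ D - real y ^ D))"
      proof (rule sum_mono)
        fix y
        have "norm (g (Suc y) - g y) \<le> 2 * pi * \<bar>d / real q * real (Suc y) ^ D - d / real q * real y ^ D\<bar>"
          unfolding g_def by (rule norm_ecis_diff_le)
        also have "\<dots> = 2 * pi * (\<bar>d\<bar> / real q * \<bar>real (Suc y) ^ D - real y ^ D\<bar>)"
          by (simp only: abs_mult abs_divide abs_of_nat flip: right_diff_distrib)
        also have "\<bar>real (Suc y) ^ D - real y ^ D\<bar> = real (Suc y) ^ D - real y ^ D"
          using power_mono[of "real y" "real (Suc y)" D] by simp
        finally show "norm (g (Suc y) - g y) \<le> 2 * pi * (\<bar>d\<bar> / real q) * (real (Suc y) ^ D - real y ^ D)"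
          by (simp add: mult.assoc)
      qed
      also have "\<dots> = 2 * pi * (\<bar>d\<bar> / real q) * (real b ^ D - real a ^ D)"
        unfolding sum_distrib_left[symmetric] using sum_Suc_diff'[OF ab, of "\<lambda>y. real y ^ D"] by simp
      also have "\<dots> \<le> 7 * (M ^ K1 / real N ^ D) * (2 * real N) ^ D"
      proof (intro mult_mono)
        show "2 * pi \<le> 7" using pi_approx by simp
        have "\<bar>d\<bar> / real q \<le> \<bar>d\<bar> / 1" using q by (intro divide_left_mono) auto
        thus "\<bar>d\<bar> / real q \<le> M ^ K1 / real N ^ D" using d by simp
        have "real b ^ D \<le> (2 * real N) ^ D" using b N by (intro power_mono) auto
        moreover have "0 \<le> real a ^ D" by simp
        ultimately show "real b ^ D - real a ^ D \<le> (2 * real N) ^ D" by linarith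
        show "0 \<le> real b ^ D - real a ^ D" using ab by (simp add: power_mono)
      qed (use M in auto)
      also have "\<dots> = 7 * (2 ^ D * M ^ K1)" using N by (simp add: power_mult_distrib)
      also have "\<dots> \<le> 7 * (M ^ D * M ^ K1)" using M by (intro mult_left_mono mult_right_mono power_mono) auto
      also have "\<dots> = 7 * M ^ (K1 + D)" by (simp add: power_add)
      finally have "norm (g b) + (\<Sum>y\<in>{a..<b}. norm (g (Suc y) - g y)) \<le> 1 + 7 * M ^ (K1 + D)"
        by (simp add: g_def)
      also have "\<dots> \<le> 2 ^ 3 * M ^ (K1 + D)" using M one_le_power[of M "K1 + D"] by simp
      also have "\<dots> \<le> M ^ 3 * M ^ (K1 + D)" using M by (intro mult_right_mono power_mono) auto
      finally show ?thesis by (simp add: K2_def power_add mult_ac)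
    qed
    obtain v where v: "v \<in> {a..b}" "norm (\<Sum>y\<in>{a..<b}. (h y * ecis (poly p' (real y))) * g y) \<le>
        norm (\<Sum>y\<in>{a..<v}. h y * ecis (poly p' (real y))) * (norm (g b) + (\<Sum>y\<in>{a..<b}. norm (g (Suc y) - g y)))"
      using norm_sum_mult_le[OF ab, of "\<lambda>y. h y * ecis (poly p' (real y))" g] by blast
    \<comment> \<open>y^D modulo q depends only on y modulo q, and an error divisible by q changes A
      y^D / q by an integer.\<close>
    have "h y = h (y mod q)" for y
    proof -
      have "int (y mod q) ^ D mod int q = int y ^ D mod int q"
        by (simp add: zmod_int power_mod)
      hence "int q dvd int y ^ D - int (y mod q) ^ D" by (metis mod_eq_dvd_iff)
      then obtain t where t: "int y ^ D - int (y mod q) ^ D = int q * t" by blast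
      have "real y ^ D - real (y mod q) ^ D = real_of_int (int y ^ D - int (y mod q) ^ D)" by simp
      also have "\<dots> = real q * of_int t" by (simp only: t of_int_mult of_int_of_nat_eq)
      finally have t': "real y ^ D = real (y mod q) ^ D + real q * of_int t" by simp
      show ?thesis unfolding h_def
      proof (rule ecis_eq_if_diff_int)
        show "of_int A * real y ^ D / real q - of_int A * real (y mod q) ^ D / real q = of_int (A * t)"
          unfolding t' using q by (simp add: field_simps)
      qed
    qed
    then obtain s where s: "s < q" "norm (\<Sum>y\<in>{a..<v}. h y * ecis (poly p' (real y))) \<le>
        real q * norm (\<Sum>y\<in>{a..<v}. ecis (real s / real q * real y) * ecis (poly p' (real y)))"
      using periodic_twist[OF q(1), of h "{a..<v}" "\<lambda>y. ecis (poly p' (real y))"] by (auto simp: h_def)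
    define p2 where "p2 = p' + monom (real s / real q) 1"
    define X where "X = norm (\<Sum>y\<in>{a..<v}. ecis (poly p2 (real y)))"
    have X: "X = norm (\<Sum>y\<in>{a..<v}. ecis (real s / real q * real y) * ecis (poly p' (real y)))"
      by (simp add: X_def p2_def poly_monom add.commute flip: ecis_add)
    have "real N / M \<le> (real q * X) * M ^ K2"
      using S v(2) s(2) unfolding fac X[symmetric]
      by (smt (verit) M mult_mono var norm_ge_zero sum_nonneg)
    also have "\<dots> \<le> (M ^ K3 * X) * M ^ K2"
      using q M by (intro mult_right_mono) (auto simp: X_def)
    finally have "real N / M \<le> (M ^ K3 * X) * M ^ K2" .
    hence X2: "real N / M ^ E \<le> X" using M by (simp add: E_def power_add field_simps)
    have "M ^ 1 \<le> M ^ E" using M by (intro power_increasing) (auto simp: E_def)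
    hence ME: "2 \<le> M ^ E" using M by simp
    have "degree p2 \<le> Suc k" unfolding p2_def
      using p' by (intro degree_add_le) (auto intro: order_trans[OF degree_monom_le])
    from K[OF ME N this a _ X2[unfolded X_def]] v(1) b obtain q2 where q2: "1 \<le> q2" "real q2 \<le> (M ^ E) ^ K"
      "nid (real q2 * coeff p2 1) \<le> (M ^ E) ^ K / real N" by auto
    show "\<exists>q\<ge>1. real q \<le> M ^ (E * K + K3) \<and> nid (real q * coeff p 1) \<le> M ^ (E * K + K3) / real N"
    proof (intro exI[of _ "q2 * q"] conjI)
      show "1 \<le> q2 * q" using q q2 by simp
      have "real q2 * real q \<le> (M ^ E) ^ K * M ^ K3" using q q2 M by (intro mult_mono) auto
      thus "real (q2 * q) \<le> M ^ (E * K + K3)" by (simp add: power_add power_mult)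
      \<comment> \<open>Multiplication by q clears the shift s / q: it becomes the integer q2 s,
        which \<open>nid\<close> does not see.\<close>
      have "real q * (real q2 * coeff p2 1) = real (q2 * q) * coeff p 1 + of_int (int q2 * int s)"
        using q(1) by (simp add: p2_def cp'[unfolded One_nat_def] algebra_simps)
      hence "nid (real (q2 * q) * coeff p 1) = nid (real q * (real q2 * coeff p2 1))"
        by (simp only: nid_add_int)
      also have "\<dots> \<le> real q * nid (real q2 * coeff p2 1)" by (rule nid_mult_nat_le)
      also have "\<dots> \<le> M ^ K3 * ((M ^ E) ^ K / real N)" using q q2 M by (intro mult_mono) auto
      finally show "nid (real (q2 * q) * coeff p 1) \<le> M ^ (E * K + K3) / real N"
        by (simp add: power_add power_mult mult_ac)
    qed
  qed
qed

section \<open>Exponential sums with a non-Liouville linear coefficient\<close>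

text \<open>The definition of Liouville speaks of denominators exceeding 1 only. Expanding p / q to
  2p / 2q covers q = 1 as well, and this is the origin of the factor 2.\<close>

lemma not_liouville_nid:
  assumes "\<not> liouville \<alpha>"
  shows "\<exists>n\<ge>1. \<forall>q\<ge>1. 1 / (2 * real q) ^ n \<le> nid (real q * \<alpha>)"
proof -
  obtain n where n: "n \<ge> 1" "\<And>p q :: int. q > 1 \<Longrightarrow>
      \<bar>\<alpha> - real_of_int p / real_of_int q\<bar> > 1 / real_of_int q ^ n"
    using assms unfolding liouville_def by (metis not_le)
  show ?thesis
  proof (intro exI[of _ n] conjI allI impI)
    fix q :: nat assume q: "q \<ge> 1"
    obtain p where p: "nid (real q * \<alpha>) = \<bar>real q * \<alpha> - of_int p\<bar>" by (rule nidE)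
    have "1 / (2 * real q) ^ n = 1 / real_of_int (2 * int q) ^ n" by simp
    also have "\<dots> \<le> \<bar>\<alpha> - real_of_int (2 * p) / real_of_int (2 * int q)\<bar>"
      using n(2)[of "2 * int q" "2 * p"] q by simp
    also have "\<dots> = \<bar>real q * \<alpha> - of_int p\<bar> / real q"
    proof -
      have "\<alpha> - real_of_int (2 * p) / real_of_int (2 * int q) = (real q * \<alpha> - of_int p) / real q"
        using q by (simp add: field_simps)
      thus ?thesis by (simp add: abs_divide)
    qed
    also have "\<dots> \<le> \<bar>real q * \<alpha> - of_int p\<bar> / 1"
      using q by (intro divide_left_mono) auto
    finally show "1 / (2 * real q) ^ n \<le> nid (real q * \<alpha>)" by (simp add: p)
  qed (use n in auto)
qed

text \<open>If the sum were larger, \<open>weyl_linear\<close> for h p would give q with q h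
  \<alpha> within M^K / N of an integer. But 2 q h is at most M^(K + 2), so this distance is at
  least M^(-(K + 2) n), which is impossible for N beyond the stated power of M.\<close>

lemma expsum_not_liouville:
  assumes "\<not> liouville \<alpha>"
  shows "\<exists>K::nat. \<forall>M::real. \<forall>N h::nat. \<forall>p :: real poly. 2 \<le> M \<longrightarrow> M ^ K < real N \<longrightarrow>
     degree p \<le> Suc k \<longrightarrow> coeff p 1 = \<alpha> \<longrightarrow> 1 \<le> h \<longrightarrow> real h \<le> M \<longrightarrow>
     norm (\<Sum>y\<in>{1..N}. ecis (real h * poly p (real y))) \<le> real N / M"
proof -
  obtain n where n: "n \<ge> 1" "\<And>q. q \<ge> 1 \<Longrightarrow> 1 / (2 * real q) ^ n \<le> nid (real q * \<alpha>)"
    using not_liouville_nid[OF assms] by blast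
  obtain K where K: "\<And>M N a b p. 2 \<le> M \<Longrightarrow> 1 \<le> N \<Longrightarrow> degree p \<le> Suc k \<Longrightarrow> 1 \<le> a \<Longrightarrow> b \<le> Suc N \<Longrightarrow>
     real N / M \<le> norm (\<Sum>y\<in>{a..<b}. ecis (poly p (real y))) \<Longrightarrow>
     (\<exists>q::nat. 1 \<le> q \<and> real q \<le> M ^ K \<and> nid (real q * coeff p 1) \<le> M ^ K / real N)"
    using weyl_linear[of k] by metis
  show ?thesis
  proof (rule exI[of _ "K + (K + 2) * n"], intro allI impI)
    fix M :: real and N h :: nat and p :: "real poly"
    assume M: "2 \<le> M" and N: "M ^ (K + (K + 2) * n) < real N" and p: "degree p \<le> Suc k" "coeff p 1 = \<alpha>"
      and h: "1 \<le> h" "real h \<le> M"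
    have "0 < M ^ (K + (K + 2) * n)" using M by simp
    hence "0 < real N" using N by linarith
    hence N1: "1 \<le> N" by simp
    show "norm (\<Sum>y\<in>{1..N}. ecis (real h * poly p (real y))) \<le> real N / M"
    proof (rule ccontr)
      assume "\<not> ?thesis"
      hence S: "real N / M \<le> norm (\<Sum>y\<in>{1..<Suc N}. ecis (poly (smult (real h) p) (real y)))"
        by (simp add: atLeastLessThanSuc_atLeastAtMost)
      obtain q where q: "1 \<le> q" "real q \<le> M ^ K" "nid (real q * (real h * \<alpha>)) \<le> M ^ K / real N"
        using K[OF M N1 order_trans[OF degree_smult_le p(1)] _ _ S] p(2) by auto
      have "2 * real (q * h) \<le> M ^ (K + 2)"
      proof -
        have "2 * real (q * h) = real q * real h * 2" by simp
        also have "\<dots> \<le> M ^ K * M * M" using q h M by (intro mult_mono) auto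
        finally show ?thesis by (simp add: power_add power2_eq_square mult_ac)
      qed
      hence "(2 * real (q * h)) ^ n \<le> (M ^ (K + 2)) ^ n" by (intro power_mono) auto
      hence "1 / (M ^ (K + 2)) ^ n \<le> 1 / (2 * real (q * h)) ^ n"
        using q h by (intro divide_left_mono) auto
      also have "\<dots> \<le> nid (real (q * h) * \<alpha>)" using q h by (intro n) auto
      also have "\<dots> \<le> M ^ K / real N" using q by (simp add: mult_ac)
      finally have "real N \<le> M ^ K * (M ^ (K + 2)) ^ n" using M N1 by (simp add: field_simps)
      also have "M ^ K * (M ^ (K + 2)) ^ n = M ^ (K + (K + 2) * n)"
        by (simp only: power_add[of M K "(K + 2) * n"] power_mult)
      finally show False using N by simp
    qed
  qed
qed

section \<open>From exponential sums to discrepancy by the Fejer kernel\<close>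

lemma card_nats_le:
  fixes S :: "nat set"
  assumes "\<And>x y. x \<in> S \<Longrightarrow> y \<in> S \<Longrightarrow> real x - real y \<le> B" "B \<ge> 0"
  shows "real (card S) \<le> B + 1"
proof -
  have "real (card (int ` S)) \<le> B + 1"
    by (rule card_ints_le(2)) (use assms in auto)
  thus ?thesis by (simp add: card_image)
qed

text \<open>For H > 0 this is the Fejer kernel, with value H at the integers and mean 1 over a
  period. As a squared norm it is visibly nonnegative and needs no quotient of sines.\<close>

definition fejer :: "nat \<Rightarrow> real \<Rightarrow> real" where
  "fejer H t = (norm (\<Sum>j<H. ecis (real j * t)))\<^sup>2 / real H"

lemma fejer_nonneg [simp]: "0 \<le> fejer H t"
  by (simp add: fejer_def)

lemma fejer_expand:
  "of_real (fejer H t) = (\<Sum>i<H. \<Sum>j<H. ecis (of_int (int i - int j) * t)) / of_nat H"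
proof -
  let ?S = "\<Sum>j<H. ecis (real j * t)"
  have "of_real ((norm ?S)\<^sup>2) = ?S * cnj ?S" by (rule complex_norm_square)
  also have "\<dots> = (\<Sum>i<H. \<Sum>j<H. ecis (of_int (int i - int j) * t))"
    by (simp add: sum_product cnj_ecis algebra_simps flip: ecis_add)
  finally show ?thesis by (simp add: fejer_def)
qed

lemma fejer_le:
  assumes "H > 0"
  shows "fejer H t * (nid t)\<^sup>2 \<le> 4 / real H"
proof -
  have "norm (\<Sum>y\<in>{0..<int H}. ecis (t * of_int y + 0)) * nid t \<le> 2"
    by (rule norm_geometric_ecis)
  also have "(\<Sum>y\<in>{0..<int H}. ecis (t * of_int y + 0)) = (\<Sum>j<H. ecis (real j * t))"
    by (rule sum.reindex_bij_witness[of _ int nat]) (auto simp: mult.commute)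
  finally have "(norm (\<Sum>j<H. ecis (real j * t)) * nid t)\<^sup>2 \<le> 2\<^sup>2"
    by (intro power_mono) auto
  hence "(norm (\<Sum>j<H. ecis (real j * t)) * nid t)\<^sup>2 / real H \<le> 4 / real H"
    by (intro divide_right_mono) auto
  thus ?thesis by (simp add: fejer_def power_mult_distrib)
qed

text \<open>Summing over the grid kills every frequency i - j not divisible by H. Since |i - j| < H
  only the diagonal survives, so the translates are a constant multiple of a partition of
  unity.\<close>

lemma sum_fejer_grid:
  assumes "H > 0"
  shows "(\<Sum>g<H. fejer H (t - real g / real H)) = real H"
proof -
  have "of_real (\<Sum>g<H. fejer H (t - real g / real H)) =
      (\<Sum>g<H. (\<Sum>i<H. \<Sum>j<H. ecis (of_int (int i - int j) * (t - real g / real H))) / of_nat H)"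
    by (simp only: of_real_sum fejer_expand)
  also have "\<dots> = (\<Sum>g<H. \<Sum>i<H. \<Sum>j<H. ecis (of_int (int i - int j) * (t - real g / real H))) / of_nat H"
    by (simp only: sum_divide_distrib)
  also have "(\<Sum>g<H. \<Sum>i<H. \<Sum>j<H. ecis (of_int (int i - int j) * (t - real g / real H))) =
      (\<Sum>i<H. \<Sum>g<H. \<Sum>j<H. ecis (of_int (int i - int j) * (t - real g / real H)))"
    by (rule sum.swap)
  also have "\<dots> = (\<Sum>i<H. \<Sum>j<H. \<Sum>g<H. ecis (of_int (int i - int j) * (t - real g / real H)))"
    by (rule sum.cong[OF refl], rule sum.swap)
  also have "\<dots> = (\<Sum>i<H. \<Sum>j<H. ecis (of_int (int i - int j) * t) * (\<Sum>g<H. ecis (real g * (of_int (int j - int i) / real H))))"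
  proof (intro sum.cong[OF refl], unfold sum_distrib_left, intro sum.cong[OF refl])
    fix i j g
    have "of_int (int i - int j) * (t - real g / real H) =
        of_int (int i - int j) * t + real g * (of_int (int j - int i) / real H)"
      using assms by (simp add: field_simps)
    thus "ecis (of_int (int i - int j) * (t - real g / real H)) =
        ecis (of_int (int i - int j) * t) * ecis (real g * (of_int (int j - int i) / real H))"
      by (simp only: ecis_add)
  qed
  also have "\<dots> = (\<Sum>i<H. \<Sum>j<H. if j = i then of_nat H else 0)"
  proof (intro sum.cong[OF refl])
    fix i j assume "i \<in> {..<H}" "j \<in> {..<H}"
    hence "int H dvd int j - int i \<longleftrightarrow> j = i"
      by (metis lessThan_iff mod_eq_dvd_iff mod_less of_nat_eq_iff of_nat_mod)
    thus "ecis (of_int (int i - int j) * t) * (\<Sum>g<H. ecis (real g * (of_int (int j - int i) / real H))) =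
        (if j = i then of_nat H else 0)"
      using sum_additive_characters[OF assms, of "int j - int i"] by simp
  qed
  also have "\<dots> / of_nat H = of_real (real H)" using assms by simp
  finally show ?thesis by (simp only: of_real_eq_iff)
qed

text \<open>Among the pairs (i, j), the H diagonal ones each count the points of A; the others give
  exponential sums with 1 \<le> |i - j| < H, up to conjugation. The kernel divides everything by
  H.\<close>

lemma sum_fejer_points:
  fixes u :: "'a \<Rightarrow> real"
  assumes "finite A" "H > 0" and E: "E \<ge> 0"
    and S: "\<And>h. 1 \<le> h \<Longrightarrow> h < H \<Longrightarrow> norm (\<Sum>x\<in>A. ecis (real h * u x)) \<le> E"
  shows "(\<Sum>x\<in>A. fejer H (u x - s)) \<le> real (card A) + real H * E"
proof -
  define S where "S = (\<lambda>i j. \<Sum>x\<in>A. ecis (of_int (int i - int j) * u x))"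
  have nS: "norm (S i j) \<le> (if j = i then real (card A) else 0) + E" if ij: "i < H" "j < H" for i j
  proof (cases i j rule: linorder_cases)
    case equal
    thus ?thesis using E by (simp add: S_def)
  next
    case greater
    thus ?thesis using S[of "i - j"] ij by (simp add: S_def of_nat_diff)
  next
    case less
    have "cnj (S i j) = (\<Sum>x\<in>A. ecis (real (j - i) * u x))"
      using less by (simp add: S_def cnj_ecis of_nat_diff algebra_simps)
    hence "norm (S i j) = norm (\<Sum>x\<in>A. ecis (real (j - i) * u x))" by (metis complex_mod_cnj)
    thus ?thesis using S[of "j - i"] ij less by simp
  qed
  have "of_real (\<Sum>x\<in>A. fejer H (u x - s)) =
      (\<Sum>x\<in>A. \<Sum>i<H. \<Sum>j<H. ecis (of_int (int i - int j) * (u x - s))) / of_nat H"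
    by (simp only: of_real_sum fejer_expand sum_divide_distrib)
  also have "(\<Sum>x\<in>A. \<Sum>i<H. \<Sum>j<H. ecis (of_int (int i - int j) * (u x - s))) =
      (\<Sum>i<H. \<Sum>x\<in>A. \<Sum>j<H. ecis (of_int (int i - int j) * (u x - s)))"
    by (rule sum.swap)
  also have "\<dots> = (\<Sum>i<H. \<Sum>j<H. \<Sum>x\<in>A. ecis (of_int (int i - int j) * (u x - s)))"
    by (rule sum.cong[OF refl], rule sum.swap)
  also have "\<dots> = (\<Sum>i<H. \<Sum>j<H. ecis (- (of_int (int i - int j) * s)) * S i j)"
    unfolding S_def sum_distrib_left ecis_add[symmetric]
    by (intro sum.cong[OF refl] arg_cong[where f = ecis]) (simp add: algebra_simps)
  finally have eq: "of_real (\<Sum>x\<in>A. fejer H (u x - s)) =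
      (\<Sum>i<H. \<Sum>j<H. ecis (- (of_int (int i - int j) * s)) * S i j) / of_nat H" .
  have "\<bar>\<Sum>x\<in>A. fejer H (u x - s)\<bar> = norm (of_real (\<Sum>x\<in>A. fejer H (u x - s)) :: complex)"
    by (simp only: norm_of_real)
  also have "\<dots> = norm (\<Sum>i<H. \<Sum>j<H. ecis (- (of_int (int i - int j) * s)) * S i j) / real H"
    unfolding eq by (simp add: norm_divide)
  also have "norm (\<Sum>i<H. \<Sum>j<H. ecis (- (of_int (int i - int j) * s)) * S i j) \<le>
      (\<Sum>i<H. \<Sum>j<H. (if j = i then real (card A) else 0) + E)"
    using nS by (intro order_trans[OF norm_sum] sum_mono) (simp add: norm_mult)
  also have "\<dots> = real H * (real (card A) + real H * E)"
    by (simp add: sum.distrib algebra_simps)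
  also have "\<dots> / real H = real (card A) + real H * E" using assms by simp
  finally show ?thesis by (simp add: divide_right_mono)
qed

lemma card_grid_near_arc:
  assumes "0 \<le> a" "a \<le> b" "b \<le> 1" "0 < \<eta>" "\<eta> \<le> 1" "H > 0"
  shows "real (card {g. g < H \<and> (\<exists>t. a \<le> t \<and> t < b \<and> nid (t - real g / real H) < \<eta>)})
    \<le> real H * (b - a + 4 * \<eta>) + 3"
proof -
  let ?J = "{g. g < H \<and> (\<exists>t. a \<le> t \<and> t < b \<and> nid (t - real g / real H) < \<eta>)}"
  \<comment> \<open>\<open>J1\<close> catches the grid points next to the arc itself,
    \<open>J2\<close> and \<open>J3\<close> those reached by wrapping around at 0 and 1; they
    correspond to m = 0, 1 and -1 below.\<close>
  define J1 where "J1 = {g. g < H \<and> a - \<eta> < real g / real H \<and> real g / real H < b + \<eta>}"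
  define J2 where "J2 = {g. g < H \<and> real g / real H < \<eta>}"
  define J3 where "J3 = {g. g < H \<and> real g / real H > 1 - \<eta>}"
  have diff: "real x - real y \<le> real H * c" if "real x / real H - real y / real H \<le> c" for x y c
    using that assms by (simp add: field_simps flip: diff_divide_distrib)
  have lt1: "real g / real H < 1" "0 \<le> real g / real H" if "g < H" for g
    using that by auto
  have c1: "real (card J1) \<le> real H * (b - a + 2 * \<eta>) + 1"
    using assms by (intro card_nats_le diff) (auto simp: J1_def)
  have c2: "real (card J2) \<le> real H * \<eta> + 1"
    using assms by (intro card_nats_le diff) (auto simp: J2_def intro!: add_increasing2 less_imp_le, smt (verit) lt1)
  have c3: "real (card J3) \<le> real H * \<eta> + 1"
    using assms by (intro card_nats_le diff) (auto simp: J3_def, smt (verit) lt1)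
  have "?J \<subseteq> J1 \<union> (J2 \<union> J3)"
  proof
    fix g assume "g \<in> ?J"
    then obtain t where t: "g < H" "a \<le> t" "t < b" "nid (t - real g / real H) < \<eta>" by blast
    obtain m where m: "nid (t - real g / real H) = \<bar>t - real g / real H - of_int m\<bar>" by (rule nidE)
    have "\<bar>real_of_int m\<bar> < 2" using t m lt1[OF t(1)] assms by linarith
    hence "m = 0 \<or> m = 1 \<or> m = - 1" by linarith
    thus "g \<in> J1 \<union> (J2 \<union> J3)"
      using t m lt1[OF t(1)] assms unfolding J1_def J2_def J3_def by (elim disjE) auto
  qed
  moreover have "finite (J1 \<union> (J2 \<union> J3))" by (simp add: J1_def J2_def J3_def)
  ultimately have "card ?J \<le> card (J1 \<union> (J2 \<union> J3))" by (intro card_mono)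
  also have "\<dots> \<le> card J1 + card (J2 \<union> J3)" by (rule card_Un_le)
  also have "\<dots> \<le> card J1 + (card J2 + card J3)" using card_Un_le[of J2 J3] by simp
  finally have "real (card ?J) \<le> real (card J1) + (real (card J2) + real (card J3))" by linarith
  thus ?thesis using c1 c2 c3 by (simp add: algebra_simps)
qed

text \<open>Double count the kernel mass between the points in the arc and the grid points within 1
  / G of the arc. Each such point keeps its whole mass H up to 4 G^2, while each grid point receives
  little more than \<open>card A\<close>. With \<open>H = G ^ 3\<close> the kernel tail costs a
  relative 4 / G, and the exponential sums cost even less.\<close>

lemma discrepancy_upper:
  fixes u :: "'a \<Rightarrow> real" and G :: nat
  assumes "finite A" "G \<ge> 1"
    and ab: "0 \<le> a" "a \<le> b" "b \<le> 1"
    and S: "\<And>h. 1 \<le> h \<Longrightarrow> h < G ^ 3 \<Longrightarrow> norm (\<Sum>x\<in>A. ecis (real h * u x)) \<le> real (card A) / real G ^ 6"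
  shows "real (card {x \<in> A. a \<le> frac (u x) \<and> frac (u x) < b}) \<le> real (card A) * (b - a + 25 / real G)"
proof -
  define H where "H = G ^ 3"
  define N where "N = real (card A)"
  define B where "B = {x \<in> A. a \<le> frac (u x) \<and> frac (u x) < b}"
  define J where "J = {g. g < H \<and> (\<exists>t. a \<le> t \<and> t < b \<and> nid (t - real g / real H) < 1 / real G)}"
  have H: "H > 0" "real H = real G ^ 3" using assms by (auto simp: H_def)
  have J: "J \<subseteq> {..<H}" "finite J" by (auto simp: J_def)
  have cJ: "real (card J) \<le> real H * (b - a + 4 / real G) + 3"
    using card_grid_near_arc[OF ab, of "1 / real G" H] assms H by (simp add: J_def)
  have BA: "B \<subseteq> A" "finite B" using assms by (auto simp: B_def)
  have lower: "real H - 4 * real G ^ 2 \<le> (\<Sum>g\<in>J. fejer H (u x - real g / real H))" if x: "x \<in> B" for x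
  proof -
    have "(\<Sum>g\<in>{..<H} - J. fejer H (u x - real g / real H)) \<le> (\<Sum>g\<in>{..<H} - J. 4 / real H * real G ^ 2)"
    proof (rule sum_mono)
      fix g assume g: "g \<in> {..<H} - J"
      have "nid (u x - real g / real H) = nid (frac (u x) - real g / real H)"
        using nid_add_int[of "frac (u x) - real g / real H" "\<lfloor>u x\<rfloor>"] by (simp add: frac_def algebra_simps)
      hence "1 / real G \<le> nid (u x - real g / real H)"
        using g x by (auto simp: J_def B_def not_less)
      hence "(1 / real G)\<^sup>2 \<le> (nid (u x - real g / real H))\<^sup>2"
        by (intro power_mono) auto
      hence "fejer H (u x - real g / real H) * (1 / real G)\<^sup>2 \<le> 4 / real H"
        using fejer_le[OF H(1), of "u x - real g / real H"]
          mult_left_mono[of _ _ "fejer H (u x - real g / real H)"] by (meson fejer_nonneg order_trans)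
      thus "fejer H (u x - real g / real H) \<le> 4 / real H * real G ^ 2"
        using assms(2) by (simp add: field_simps)
    qed
    also have "\<dots> \<le> (\<Sum>g\<in>{..<H}. 4 / real H * real G ^ 2)"
      by (intro sum_mono2) auto
    also have "\<dots> = 4 * real G ^ 2" using H by simp
    finally have "(\<Sum>g\<in>{..<H} - J. fejer H (u x - real g / real H)) \<le> 4 * real G ^ 2" .
    moreover have "(\<Sum>g<H. fejer H (u x - real g / real H)) =
        (\<Sum>g\<in>{..<H} - J. fejer H (u x - real g / real H)) + (\<Sum>g\<in>J. fejer H (u x - real g / real H))"
      using J by (intro sum.subset_diff) auto
    ultimately show ?thesis using sum_fejer_grid[OF H(1), of "u x"] by linarith
  qed
  have "real (card B) * (real H - 4 * real G ^ 2) = (\<Sum>x\<in>B. real H - 4 * real G ^ 2)" by simp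
  also have "\<dots> \<le> (\<Sum>x\<in>B. \<Sum>g\<in>J. fejer H (u x - real g / real H))"
    by (intro sum_mono lower)
  also have "\<dots> \<le> (\<Sum>x\<in>A. \<Sum>g\<in>J. fejer H (u x - real g / real H))"
    using BA assms(1) by (intro sum_mono2) (auto intro: sum_nonneg)
  also have "\<dots> = (\<Sum>g\<in>J. \<Sum>x\<in>A. fejer H (u x - real g / real H))" by (rule sum.swap)
  also have "\<dots> \<le> (\<Sum>g\<in>J. N + real H * (N / real G ^ 6))"
    unfolding N_def by (intro sum_mono sum_fejer_points) (use assms S H in \<open>auto simp: H_def\<close>)
  also have "\<dots> = real (card J) * (N + real H * (N / real G ^ 6))" by simp
  also have "\<dots> \<le> (real H * (b - a + 4 / real G) + 3) * (N + real H * (N / real G ^ 6))"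
    using cJ by (intro mult_right_mono) (auto simp: N_def)
  finally have main: "real (card B) * (real H - 4 * real G ^ 2) \<le>
      (real H * (b - a + 4 / real G) + 3) * (N + real H * (N / real G ^ 6))" .
  \<comment> \<open>After division by H all errors are constant multiples of powers of x, and higher
    powers are at most x.\<close>
  define x where "x = 1 / real G"
  have x: "0 < x" "x \<le> 1" using assms(2) by (auto simp: x_def)
  have xp: "x ^ i \<le> x" if "i \<ge> 1" for i
    using power_decreasing[of 1 i x] x that by simp
  have G: "real G = 1 / x" using assms(2) by (simp add: x_def)
  have "real (card B) * (1 - 4 * x) \<le> (b - a + 4 * x + 3 * x ^ 3) * (N * (1 + x ^ 3))"
  proof -
    have "real (card B) * (real H - 4 * real G ^ 2) = real H * (real (card B) * (1 - 4 * x))"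
      unfolding H G using x by (simp add: field_simps power3_eq_cube power2_eq_square)
    moreover have "(real H * (b - a + 4 / real G) + 3) * (N + real H * (N / real G ^ 6)) =
        real H * ((b - a + 4 * x + 3 * x ^ 3) * (N * (1 + x ^ 3)))"
      unfolding H G using x by (simp add: field_simps power_divide)
    ultimately have "real H * (real (card B) * (1 - 4 * x)) \<le>
        real H * ((b - a + 4 * x + 3 * x ^ 3) * (N * (1 + x ^ 3)))"
      using main by (simp only:)
    thus ?thesis using H(1) by (simp only: mult_le_cancel_left_pos of_nat_0_less_iff)
  qed
  also have "\<dots> \<le> (b - a + 7 * x) * (N * (1 + x))"
    using ab xp[of 3] x by (intro mult_mono) (auto simp: N_def)
  also have "\<dots> = N * (b - a + 7 * x + (b - a) * x + 7 * x\<^sup>2)"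
    by (simp add: algebra_simps power2_eq_square)
  also have "\<dots> \<le> N * (b - a + 7 * x + 1 * x + 7 * x)"
    using ab x xp[of 2] by (intro mult_left_mono add_mono mult_right_mono) (auto simp: N_def)
  finally have *: "real (card B) * (1 - 4 * x) \<le> N * (b - a + 15 * x)" by (simp add: algebra_simps)
  \<comment> \<open>The trivial bound \<open>card B \<le> card A\<close> pays for the factor 1 - 4
    x, even where that factor is not positive.\<close>
  have "real (card B) * x \<le> N * x"
    using card_mono[OF assms(1) BA(1)] x by (simp add: N_def)
  hence "real (card B) \<le> N * (b - a + 15 * x) + 4 * (N * x)"
    using * by (simp add: algebra_simps)
  also have "\<dots> \<le> N * (b - a + 25 * x)"
    using x by (simp add: N_def algebra_simps)
  finally show ?thesis by (simp add: B_def N_def x_def)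
qed

text \<open>The lower bound is the upper bound for the complementary arc from \<beta> to 1.\<close>

lemma discrepancy:
  fixes u :: "'a \<Rightarrow> real" and G :: nat
  assumes "finite A" "G \<ge> 1" "0 \<le> \<beta>" "\<beta> \<le> 1"
    and S: "\<And>h. 1 \<le> h \<Longrightarrow> h < G ^ 3 \<Longrightarrow> norm (\<Sum>x\<in>A. ecis (real h * u x)) \<le> real (card A) / real G ^ 6"
  shows "\<bar>real (card {x \<in> A. frac (u x) < \<beta>}) - \<beta> * real (card A)\<bar> \<le> 25 * real (card A) / real G"
proof -
  have up: "real (card {x \<in> A. frac (u x) < \<beta>}) \<le> real (card A) * (\<beta> + 25 / real G)"
    using discrepancy_upper[OF assms(1,2) _ assms(3,4) S] by simp
  have lo: "real (card {x \<in> A. \<beta> \<le> frac (u x)}) \<le> real (card A) * (1 - \<beta> + 25 / real G)"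
    using discrepancy_upper[OF assms(1,2,3,4) _ S] by (simp add: frac_lt_1)
  have "A = {x \<in> A. frac (u x) < \<beta>} \<union> {x \<in> A. \<beta> \<le> frac (u x)}" by auto
  also have "card \<dots> = card {x \<in> A. frac (u x) < \<beta>} + card {x \<in> A. \<beta> \<le> frac (u x)}"
    using assms(1) by (intro card_Un_disjoint) auto
  finally have "real (card A) = real (card {x \<in> A. frac (u x) < \<beta>}) + real (card {x \<in> A. \<beta> \<le> frac (u x)})"
    by simp
  moreover define E where "E = 25 * real (card A) / real G"
  moreover have "real (card {x \<in> A. frac (u x) < \<beta>}) \<le> \<beta> * real (card A) + E"
    using up by (simp add: E_def algebra_simps)
  moreover have "real (card {x \<in> A. \<beta> \<le> frac (u x)}) \<le> real (card A) - \<beta> * real (card A) + E"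
    using lo by (simp add: E_def algebra_simps)
  ultimately show ?thesis by linarith
qed

text \<open>Only the linear coefficient is fixed: the bound is uniform in all the others. This is what
  allows it to be applied to \<open>P(dy) / d\<close> for every \<open>d\<close>.\<close>

lemma equidistribution_not_liouville:
  assumes "\<not> liouville \<alpha>"
  shows "\<exists>K::nat. \<forall>G N :: nat. \<forall>\<beta> :: real. \<forall>p :: real poly. 2 \<le> G \<longrightarrow> G ^ K < N \<longrightarrow>
     degree p \<le> Suc k \<longrightarrow> coeff p 1 = \<alpha> \<longrightarrow> 0 \<le> \<beta> \<longrightarrow> \<beta> \<le> 1 \<longrightarrow>
     \<bar>real (card {y \<in> {1..N}. frac (poly p (real y)) < \<beta>}) - \<beta> * real N\<bar> \<le> 25 * real N / real G"
proof -
  obtain K where K: "\<And>M N h p. 2 \<le> M \<Longrightarrow> M ^ K < real N \<Longrightarrow> degree p \<le> Suc k \<Longrightarrow>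
     coeff p 1 = \<alpha> \<Longrightarrow> 1 \<le> h \<Longrightarrow> real h \<le> M \<Longrightarrow>
     norm (\<Sum>y\<in>{1..N}. ecis (real h * poly p (real y))) \<le> real N / M"
    using expsum_not_liouville[OF assms, of k] by metis
  show ?thesis
  \<comment> \<open>The discrepancy bound asks for a saving of G^6, so the exponential sums are used
    with M = G^6.\<close>
  proof (rule exI[of _ "6 * K"], intro allI impI)
    fix G N :: nat and \<beta> :: real and p :: "real poly"
    assume G: "2 \<le> G" and N: "G ^ (6 * K) < N" and p: "degree p \<le> Suc k" "coeff p 1 = \<alpha>"
      and \<beta>: "0 \<le> \<beta>" "\<beta> \<le> 1"
    have G6: "2 \<le> real G ^ 6"
    proof -
      have "2 \<le> real G ^ 1" using G by simp
      also have "\<dots> \<le> real G ^ 6" using G by (intro power_increasing) auto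
      finally show ?thesis .
    qed
    have "norm (\<Sum>y\<in>{1..N}. ecis (real h * poly p (real y))) \<le> real (card {1..N}) / real G ^ 6"
      if h: "1 \<le> h" "h < G ^ 3" for h
    proof -
      have "real h \<le> real G ^ 3" using h by (metis less_imp_le of_nat_le_iff of_nat_power)
      also have "\<dots> \<le> real G ^ 6" using G by (intro power_increasing) auto
      finally have "real h \<le> real G ^ 6" .
      moreover have "(real G ^ 6) ^ K < real N" using N by (metis of_nat_less_iff of_nat_power power_mult)
      ultimately show ?thesis using K[OF G6 _ p] h by simp
    qed
    from discrepancy[OF _ _ \<beta> this] G
    show "\<bar>real (card {y \<in> {1..N}. frac (poly p (real y)) < \<beta>}) - \<beta> * real N\<bar> \<le> 25 * real N / real G"
      by simp
  qed
qed

section \<open>Sieving\<close>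

text \<open>Sieve of Eratosthenes on the series: the multiples of a new prime p among the surviving
  n are exactly p times the surviving n, so removing them multiplies the sum by 1 - 1 / p^2.\<close>

lemma has_sum_sieve:
  fixes T :: "nat set"
  assumes "finite T" "\<And>p. p \<in> T \<Longrightarrow> prime p"
  shows "((\<lambda>n. 1 / (real n)\<^sup>2) has_sum (zeta 2 * (\<Prod>p\<in>T. 1 - 1 / (real p)\<^sup>2)))
    {n. 1 \<le> n \<and> (\<forall>p\<in>T. \<not> p dvd n)}"
  using assms
proof (induction T rule: finite_induct)
  case empty
  have "((\<lambda>n. 1 / (real n + 1)\<^sup>2) has_sum zeta 2) UNIV"
    unfolding zeta_2 using inverse_squares_sums by (intro sums_nonneg_imp_has_sum) (simp_all add: add.commute)
  also have "?this \<longleftrightarrow> ((\<lambda>n. 1 / (real n)\<^sup>2) has_sum zeta 2) {n. 1 \<le> n}"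
    by (rule has_sum_reindex_bij_witness[of _ "\<lambda>n. n - 1" Suc]) (auto simp: add.commute)
  finally show ?case by simp
next
  case (insert p T)
  let ?f = "\<lambda>n. 1 / (real n)\<^sup>2" and ?S = "{n. 1 \<le> n \<and> (\<forall>q\<in>T. \<not> q dvd n)}"
  let ?v = "zeta 2 * (\<Prod>q\<in>T. 1 - 1 / (real q)\<^sup>2)"
  have p: "prime p" and T: "\<And>q. q \<in> T \<Longrightarrow> prime q" using insert.prems by auto
  have p0: "p > 0" using p by (simp add: prime_gt_0_nat)
  have IH: "(?f has_sum ?v) ?S" using insert.IH T by auto
  have coprime_T: "q dvd p * n \<longleftrightarrow> q dvd n" if "q \<in> T" for q n
    using p T[OF that] insert.hyps(2) that by (metis prime_dvd_mult_iff primes_dvd_imp_eq dvd_triv_right dvd_mult)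
  have im: "(\<lambda>m. p * m) ` ?S = {n \<in> ?S. p dvd n}"
  proof (intro equalityI subsetI)
    fix n assume "n \<in> {n \<in> ?S. p dvd n}"
    then obtain m where "n = p * m" "n \<in> ?S" by (auto elim: dvdE)
    thus "n \<in> (\<lambda>m. p * m) ` ?S" using coprime_T by auto
  qed (use p0 coprime_T in auto)
  have "((?f \<circ> (\<lambda>m. p * m)) has_sum (?v * (1 / (real p)\<^sup>2))) ?S"
    using has_sum_cmult_left[OF IH, of "1 / (real p)\<^sup>2"] by (simp add: o_def power_mult_distrib mult.commute)
  hence "(?f has_sum (?v * (1 / (real p)\<^sup>2))) {n \<in> ?S. p dvd n}"
    unfolding im[symmetric] using p0 by (subst has_sum_reindex) (auto simp: inj_on_def)
  hence "(?f has_sum (?v - ?v * (1 / (real p)\<^sup>2))) (?S - {n \<in> ?S. p dvd n})"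
    by (intro has_sum_Diff IH) auto
  also have "?v - ?v * (1 / (real p)\<^sup>2) = zeta 2 * (\<Prod>q\<in>insert p T. 1 - 1 / (real q)\<^sup>2)"
    using insert.hyps by (simp add: algebra_simps)
  also have "?S - {n \<in> ?S. p dvd n} = {n. 1 \<le> n \<and> (\<forall>q\<in>insert p T. \<not> q dvd n)}"
    by auto
  finally show ?case .
qed

lemma sum_inverse_squares_tail:
  assumes "z \<ge> 1"
  shows "(\<Sum>n\<in>{z<..<z + k}. 1 / (real n)\<^sup>2) \<le> 1 / real z"
proof -
  have "(\<Sum>n\<in>{z<..z + k}. 1 / (real n)\<^sup>2) \<le> 1 / real z - 1 / real (z + k)" for k
  proof (induction k)
    case (Suc k)
    have "1 / (real (Suc (z + k)))\<^sup>2 \<le> 1 / real (z + k) - 1 / real (Suc (z + k))"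
    proof -
      define x where "x = real (z + k)"
      have x: "x > 0" using assms by (simp add: x_def)
      have "1 / (x + 1)\<^sup>2 \<le> 1 / (x * (x + 1))"
        using x by (intro divide_left_mono) (auto simp: power2_eq_square)
      also have "\<dots> = 1 / x - 1 / (x + 1)" using x by (simp add: field_simps)
      finally show ?thesis by (simp add: x_def add.commute)
    qed
    moreover have "{z<..z + Suc k} = insert (Suc (z + k)) {z<..z + k}" by auto
    ultimately show ?case using Suc by simp
  qed simp
  moreover have "(\<Sum>n\<in>{z<..<z + k}. 1 / (real n)\<^sup>2) \<le> (\<Sum>n\<in>{z<..z + k}. 1 / (real n)\<^sup>2)"
    by (intro sum_mono2) auto
  moreover have "1 / real (z + k) \<ge> 0" by simp
  ultimately show ?thesis by (smt (verit))
qed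

lemma sum_inverse_squares_le:
  assumes "z \<ge> 1" "finite F" "\<And>n. n \<in> F \<Longrightarrow> z < n"
  shows "(\<Sum>n\<in>F. 1 / (real n)\<^sup>2) \<le> 1 / real z"
proof -
  obtain k where "\<forall>n\<in>F. n < k" using assms(2) finite_nat_set_iff_bounded by blast
  hence "F \<subseteq> {z<..<z + k}" using assms(3) by fastforce
  hence "(\<Sum>n\<in>F. 1 / (real n)\<^sup>2) \<le> (\<Sum>n\<in>{z<..<z + k}. 1 / (real n)\<^sup>2)"
    by (intro sum_mono2) auto
  thus ?thesis using sum_inverse_squares_tail[OF assms(1), of k] by linarith
qed

lemma zeta_2_ge_1: "1 \<le> zeta 2"
proof -
  have "3\<^sup>2 \<le> pi\<^sup>2" using pi_approx by (intro power_mono) auto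
  thus ?thesis by (simp add: zeta_2)
qed

text \<open>\<open>zeta 2\<close> times the product is the sum over the n without prime factors up
  to z. Apart from n = 1 these n exceed z, so the excess over 1 is part of the tail of the
  series.\<close>

lemma euler_product_zeta_2:
  assumes "z \<ge> 1"
  shows "\<bar>(\<Prod>p | prime p \<and> p \<le> z. 1 - 1 / (real p)\<^sup>2) - 1 / zeta 2\<bar> \<le> 1 / real z"
proof -
  let ?f = "\<lambda>n. 1 / (real n)\<^sup>2" and ?T = "{p. prime p \<and> p \<le> z}"
  let ?S = "{n. 1 \<le> n \<and> (\<forall>p\<in>?T. \<not> p dvd n)}"
  define V where "V = (\<Prod>p\<in>?T. 1 - 1 / (real p)\<^sup>2)"
  have "(?f has_sum (zeta 2 * V)) ?S" unfolding V_def by (rule has_sum_sieve) auto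
  hence "(?f has_sum (zeta 2 * V - sum ?f {1})) (?S - {1})"
    by (intro has_sum_Diff has_sum_finite) auto
  hence hs: "(?f has_sum (zeta 2 * V - 1)) (?S - {1})" by simp
  have "zeta 2 * V - 1 \<le> 1 / real z"
  proof (rule has_sum_le_finite_sums[OF hs], rule sum_inverse_squares_le[OF assms])
    fix F n assume F: "F \<subseteq> ?S - {1}" and "n \<in> F"
    hence n: "n \<noteq> 1" "1 \<le> n" "\<forall>p\<in>?T. \<not> p dvd n" by auto
    then obtain p where p: "prime p" "p dvd n" using prime_factor_nat by blast
    have "\<not> p \<le> z" using n(3) p by blast
    moreover have "p \<le> n" using p n(2) by (intro dvd_imp_le) auto
    ultimately show "z < n" by simp
  qed
  moreover have "0 \<le> zeta 2 * V - 1" by (rule has_sum_nonneg[OF hs]) auto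
  ultimately have "\<bar>zeta 2 * V - 1\<bar> \<le> 1 / real z" by simp
  moreover have "\<bar>V - 1 / zeta 2\<bar> = \<bar>zeta 2 * V - 1\<bar> / zeta 2"
  proof -
    have "V - 1 / zeta 2 = (zeta 2 * V - 1) / zeta 2"
      using zeta_2_ge_1 by (simp add: field_simps)
    thus ?thesis using zeta_2_ge_1 by (simp add: abs_divide)
  qed
  moreover have "\<bar>zeta 2 * V - 1\<bar> / zeta 2 \<le> \<bar>zeta 2 * V - 1\<bar> / 1"
    using zeta_2_ge_1 by (intro divide_left_mono) auto
  ultimately have "\<bar>V - 1 / zeta 2\<bar> \<le> 1 / real z" by simp
  thus ?thesis by (simp only: V_def)
qed

section \<open>Chebyshev's bound and reciprocals of large primes\<close>

text \<open>Distinct primes are coprime. The generality serves two uses, naturals x and integers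
  \<lfloor>P(x)\<rfloor>.\<close>

lemma prod_primes_dvd:
  fixes m :: "'a :: factorial_semiring_gcd"
  assumes "finite B" "\<And>p. p \<in> B \<Longrightarrow> prime p"
  shows "\<Prod>B dvd m \<longleftrightarrow> (\<forall>p\<in>B. p dvd m)"
  using assms
proof (induction B rule: finite_induct)
  case (insert p B)
  have "\<not> p dvd \<Prod>B"
    using insert prime_dvd_prod_iff[of B p "\<lambda>x. x"] primes_dvd_imp_eq[of p] by auto
  hence "coprime p (\<Prod>B)" using insert.prems by (intro prime_imp_coprime) auto
  thus ?case using insert by (auto dest: dvd_mult_left dvd_mult_right intro: divides_mult)
qed simp

text \<open>Chebyshev: each of these primes divides (2m)! but not m!, so their product divides the
  central binomial coefficient, which is at most 4^m. Take logarithms.\<close>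

lemma card_primes_between:
  fixes m :: nat
  assumes "m \<ge> 1"
  shows "real (card {p. prime p \<and> m < p \<and> p \<le> 2 * m}) * ln (real m) \<le> 2 * real m * ln 2"
proof -
  let ?B = "{p. prime p \<and> m < p \<and> p \<le> 2 * m}"
  have fin: "finite ?B" by (rule finite_subset[of _ "{..2 * m}"]) auto
  have "\<Prod>?B dvd (2 * m) choose m"
  proof (subst prod_primes_dvd[OF fin])
    show "\<forall>p\<in>?B. p dvd (2 * m) choose m"
    proof
      fix p assume p: "p \<in> ?B"
      have "p dvd fact (2 * m)" using p by (auto simp: prime_dvd_fact_iff)
      moreover have "fact m * fact m * ((2 * m) choose m) = (fact (2 * m) :: nat)"
        using binomial_fact_lemma[of m "2 * m"] by simp
      moreover have "\<not> p dvd (fact m :: nat)" using p by (auto simp: prime_dvd_fact_iff)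
      ultimately show "p dvd (2 * m) choose m" using p by (metis (no_types, lifting) mem_Collect_eq prime_dvd_mult_iff)
    qed
  qed auto
  hence "\<Prod>?B \<le> (2 * m) choose m" by (intro dvd_imp_le) auto
  also have "\<dots> \<le> 2 ^ (2 * m)" by (rule binomial_le_pow2)
  finally have "real (\<Prod>?B) \<le> 2 ^ (2 * m)" by (metis of_nat_le_iff of_nat_numeral of_nat_power)
  moreover have "real m ^ card ?B \<le> real (\<Prod>?B)"
  proof -
    have "(\<Prod>p\<in>?B. m) \<le> \<Prod>?B" by (intro prod_mono) auto
    hence "real (m ^ card ?B) \<le> real (\<Prod>?B)" by (simp only: of_nat_le_iff prod_constant)
    thus ?thesis by (simp only: of_nat_power)
  qed
  ultimately have "real m ^ card ?B \<le> 2 ^ (2 * m)" by linarith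
  hence "ln (real m ^ card ?B) \<le> ln (2 ^ (2 * m))" using assms by (subst ln_le_cancel_iff) auto
  thus ?thesis using assms by (simp add: ln_realpow)
qed

text \<open>Cut the range into I blocks from M to 2M. In each, Chebyshev's bound gives at most 2 ln
  2 / ln M, and M \<ge> m.\<close>

lemma sum_inverse_primes_dyadic:
  fixes m :: nat
  assumes "m \<ge> 2"
  shows "(\<Sum>p | prime p \<and> m < p \<and> p \<le> m * 2 ^ I. 1 / real p) \<le> 2 * real I * ln 2 / ln (real m)"
proof (induction I)
  case 0
  have "{p. prime p \<and> m < p \<and> p \<le> m} = {}" by auto
  thus ?case by (simp only: power_0 mult_1_right sum.empty)
next
  case (Suc I)
  define M where "M = m * 2 ^ I"
  let ?A = "{p. prime p \<and> m < p \<and> p \<le> M}" and ?B = "{p. prime p \<and> M < p \<and> p \<le> 2 * M}"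
  have mM: "m \<le> M" by (simp add: M_def)
  have fin: "finite ?A" "finite ?B"
    by (rule finite_subset[of _ "{..M}"]; auto) (rule finite_subset[of _ "{..2 * M}"]; auto)
  have M2: "m * 2 ^ Suc I = 2 * M" by (simp add: M_def)
  have "{p. prime p \<and> m < p \<and> p \<le> m * 2 ^ Suc I} = ?A \<union> ?B"
    unfolding M2 using mM by auto
  hence "(\<Sum>p | prime p \<and> m < p \<and> p \<le> m * 2 ^ Suc I. 1 / real p) =
      (\<Sum>p\<in>?A. 1 / real p) + (\<Sum>p\<in>?B. 1 / real p)"
    using fin by (simp add: sum.union_disjoint disjoint_iff)
  also have "(\<Sum>p\<in>?B. 1 / real p) \<le> (\<Sum>p\<in>?B. 1 / real M)"
    using mM assms by (intro sum_mono divide_left_mono) auto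
  also have "\<dots> = real (card ?B) / real M" by simp
  also have "\<dots> \<le> 2 * ln 2 / ln (real M)"
    using card_primes_between[of M] mM assms by (simp add: field_simps)
  also have "\<dots> \<le> 2 * ln 2 / ln (real m)"
    using mM assms by (intro divide_left_mono) auto
  finally show ?case using Suc by (simp add: M_def algebra_simps add_divide_distrib)
qed

lemma sum_inverse_le_ln:
  assumes "n \<ge> 1"
  shows "(\<Sum>d\<in>{1..n}. 1 / real d) \<le> 1 + ln (real n)"
  using assms
proof (induction n rule: nat_induct_at_least)
  case (Suc n)
  have "ln (real n / real (Suc n)) \<le> real n / real (Suc n) - 1"
    using Suc.hyps by (intro ln_le_minus_one) auto
  also have "\<dots> = - 1 / real (Suc n)" by (simp add: field_simps)
  finally have "ln (real n) - ln (real (Suc n)) \<le> - 1 / real (Suc n)"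
    using Suc.hyps by (simp add: ln_div)
  thus ?case using Suc by (simp add: atLeastAtMostSuc_conv) 
qed simp

section \<open>Joint divisibility of x and the floor of P(x)\<close>

text \<open>Writing the floor of t as d m + r, the fractional part of t / d is (r + frac t) / d, and
  this is below 1 / d exactly when r = 0.\<close>

lemma dvd_floor_iff:
  fixes t :: real and d :: nat
  assumes "d \<ge> 1"
  shows "int d dvd \<lfloor>t\<rfloor> \<longleftrightarrow> frac (t / real d) < 1 / real d"
proof -
  define m where "m = \<lfloor>t\<rfloor> div int d"
  define r where "r = \<lfloor>t\<rfloor> mod int d"
  have fl: "\<lfloor>t\<rfloor> = int d * m + r" by (simp add: m_def r_def)
  have r: "0 \<le> r" "r < int d" using assms by (simp_all add: r_def)
  have t: "t = real d * m + r + frac t" using arg_cong[OF fl, of real_of_int] by (simp add: frac_def)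
  have "t / real d = (r + frac t) / real d + of_int m"
    using assms t by (simp add: field_simps)
  moreover have "0 \<le> (r + frac t) / real d" using r by simp
  moreover have "(r + frac t) / real d < 1"
  proof -
    have "real_of_int r + 1 \<le> real d" using r(2) by linarith
    thus ?thesis using assms frac_lt_1[of t] by (simp add: divide_less_eq)
  qed
  ultimately have "frac (t / real d) = (r + frac t) / real d"
    by (subst frac_unique_iff) auto
  hence "frac (t / real d) < 1 / real d \<longleftrightarrow> r + frac t < 1"
    using assms by (simp add: divide_less_cancel)
  also have "\<dots> \<longleftrightarrow> r = 0" using r(1) frac_lt_1[of t] frac_ge_0[of t] by linarith
  also have "\<dots> \<longleftrightarrow> int d dvd \<lfloor>t\<rfloor>" by (simp add: r_def dvd_eq_mod_eq_0)
  finally show ?thesis by simp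
qed

lemma real_div_bounds:
  fixes n d :: nat
  assumes "d \<ge> 1"
  shows "real (n div d) \<le> real n / real d" "real n / real d - 1 \<le> real (n div d)"
proof -
  have "real n = real (d * (n div d) + n mod d)" by simp
  hence n: "real n = real d * real (n div d) + real (n mod d)" by (simp only: of_nat_add of_nat_mult)
  have "real (n mod d) \<le> real d" using assms by simp
  thus "real (n div d) \<le> real n / real d" "real n / real d - 1 \<le> real (n div d)"
    using assms n by (simp_all add: field_simps)
qed

lemma card_multiples_dvd_floor:
  fixes P :: "real poly"
  assumes "d \<ge> 1"
  shows "card {x \<in> {1..n}. d dvd x \<and> int d dvd \<lfloor>poly P (real x)\<rfloor>} =
    card {y \<in> {1..n div d}. frac (poly (smult (1 / real d) (pcompose P [:0, real d:])) (real y)) < 1 / real d}"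
    (is "card ?A = card ?B")
proof -
  have iff: "int d dvd \<lfloor>poly P (real (d * y))\<rfloor> \<longleftrightarrow>
      frac (poly (smult (1 / real d) (pcompose P [:0, real d:])) (real y)) < 1 / real d" for y
    using dvd_floor_iff[OF assms, of "poly P (real (d * y))"] by (simp add: poly_pcompose mult.commute)
  have "?A = (\<lambda>y. d * y) ` ?B"
  proof (intro equalityI subsetI)
    fix x assume x: "x \<in> ?A"
    then obtain y where y: "x = d * y" by auto
    have "y \<in> {1..n div d}" using x y assms by (auto simp: less_eq_div_iff_mult_less_eq mult.commute Suc_le_eq)
    thus "x \<in> (\<lambda>y. d * y) ` ?B" using x y iff[of y] by auto
  next
    fix x assume "x \<in> (\<lambda>y. d * y) ` ?B"
    then obtain y where y: "y \<in> ?B" "x = d * y" by blast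
    have "1 \<le> d * y" "d * y \<le> n"
      using y assms by (auto simp: less_eq_div_iff_mult_less_eq mult.commute Suc_le_eq)
    thus "x \<in> ?A" using y iff[of y] by auto
  qed
  moreover have "inj_on (\<lambda>y. d * y) ?B" using assms by (auto simp: inj_on_def)
  ultimately show ?thesis by (simp add: card_image)
qed

text \<open>The expected count has one factor 1 / d from x and one from the floor. W is the length
  from which equidistribution of P(d y) / d is available, and the last 1 / d allows for rounding in
  \<open>n div d\<close>.\<close>

definition divisor_equidist :: "real poly \<Rightarrow> nat \<Rightarrow> real \<Rightarrow> bool" where
  "divisor_equidist P W E \<longleftrightarrow> (\<forall>d\<ge>1. \<forall>n. W \<le> n div d \<longrightarrow>
     \<bar>real (card {x \<in> {1..n}. d dvd x \<and> int d dvd \<lfloor>poly P (real x)\<rfloor>}) - real n / (real d)\<^sup>2\<bar>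
       \<le> E * (real n / real d) + 1 / real d)"

lemma divisor_equidist_not_liouville:
  assumes "\<not> liouville (coeff P 1)"
  shows "\<exists>K. \<forall>G\<ge>2. divisor_equidist P (G ^ K + 1) (25 / real G)"
proof -
  obtain K where K: "\<forall>G N :: nat. \<forall>\<beta> :: real. \<forall>p :: real poly. 2 \<le> G \<longrightarrow> G ^ K < N \<longrightarrow>
      degree p \<le> Suc (degree P) \<longrightarrow> coeff p 1 = coeff P 1 \<longrightarrow> 0 \<le> \<beta> \<longrightarrow> \<beta> \<le> 1 \<longrightarrow>
      \<bar>real (card {y \<in> {1..N}. frac (poly p (real y)) < \<beta>}) - \<beta> * real N\<bar> \<le> 25 * real N / real G"
    using equidistribution_not_liouville[OF assms, of "degree P"] by (elim exE) (rule that)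
  have "divisor_equidist P (G ^ K + 1) (25 / real G)" if G: "2 \<le> G" for G
    unfolding divisor_equidist_def
  proof (intro allI impI)
    fix d n :: nat assume d: "1 \<le> d" and n: "G ^ K + 1 \<le> n div d"
    define p where "p = smult (1 / real d) (pcompose P [:0, real d:])"
    have "degree p \<le> degree (pcompose P [:0, real d:])"
      unfolding p_def by (rule degree_smult_le)
    also have "\<dots> \<le> Suc (degree P)" using d by (simp add: degree_pcompose)
    finally have "degree p \<le> Suc (degree P)" .
    moreover have "coeff p 1 = coeff P 1" using d by (simp add: p_def coeff_pcompose_linear)
    ultimately have "\<bar>real (card {y \<in> {1..n div d}. frac (poly p (real y)) < 1 / real d}) -
        1 / real d * real (n div d)\<bar> \<le> 25 * real (n div d) / real G"
      using K[rule_format, of G "n div d" p "1 / real d"] G n d by simp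
    moreover have nd: "real (n div d) \<le> real n / real d" "real n / real d - 1 \<le> real (n div d)"
      using real_div_bounds[OF d] by auto
    have "25 * real (n div d) / real G \<le> 25 / real G * (real n / real d)"
      using nd(1) mult_left_mono[OF nd(1), of "25 / real G"] by simp
    moreover have "1 / real d * real (n div d) \<le> real n / (real d)\<^sup>2"
        "real n / (real d)\<^sup>2 - 1 / real d \<le> 1 / real d * real (n div d)"
      using mult_left_mono[OF nd(1), of "1 / real d"] mult_left_mono[OF nd(2), of "1 / real d"]
      by (simp_all add: power2_eq_square right_diff_distrib)
    ultimately show "\<bar>real (card {x \<in> {1..n}. d dvd x \<and> int d dvd \<lfloor>poly P (real x)\<rfloor>}) - real n / (real d)\<^sup>2\<bar>
       \<le> 25 / real G * (real n / real d) + 1 / real d"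
      unfolding card_multiples_dvd_floor[OF d] p_def[symmetric] by linarith
  qed
  thus ?thesis by blast
qed

section \<open>Sieving by small and by large primes\<close>

text \<open>Inclusion-exclusion: expand the product of 1 - \<open>b p x\<close> over p in T
  pointwise and exchange the sums.\<close>

lemma card_sieve:
  fixes b :: "'p \<Rightarrow> 'a \<Rightarrow> bool"
  assumes "finite A" "finite T"
  shows "real (card {x \<in> A. \<forall>p\<in>T. \<not> b p x}) =
    (\<Sum>B\<in>Pow T. (-1) ^ card B * real (card {x \<in> A. \<forall>p\<in>B. b p x}))"
proof -
  have c: "real (card {x \<in> A. Q x}) = (\<Sum>x\<in>A. of_bool (Q x))" for Q
    using assms(1) by (simp add: of_bool_def flip: sum.inter_filter)
  have p: "(\<Prod>p\<in>B. of_bool (b p x)) = (of_bool (\<forall>p\<in>B. b p x) :: real)" if "finite B" for B x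
    using that by (induction B rule: finite_induct) auto
  have "of_bool (\<forall>p\<in>T. \<not> b p x) = (\<Sum>B\<in>Pow T. (-1) ^ card B * (of_bool (\<forall>p\<in>B. b p x) :: real))" for x
  proof -
    have "of_bool (\<forall>p\<in>T. \<not> b p x) = (\<Prod>p\<in>T. (- of_bool (b p x)) + (1::real))"
      using assms(2) by (induction T rule: finite_induct) auto
    also have "\<dots> = (\<Sum>B\<in>Pow T. (\<Prod>p\<in>B. - of_bool (b p x)) * (\<Prod>p\<in>T - B. 1))"
      by (rule prod_add[OF assms(2)])
    also have "\<dots> = (\<Sum>B\<in>Pow T. (-1) ^ card B * of_bool (\<forall>p\<in>B. b p x))"
    proof (rule sum.cong[OF refl])
      fix B assume "B \<in> Pow T"
      hence "finite B" using assms(2) by (auto intro: finite_subset)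
      thus "(\<Prod>p\<in>B. - of_bool (b p x)) * (\<Prod>p\<in>T - B. 1) = (-1) ^ card B * (of_bool (\<forall>p\<in>B. b p x) :: real)"
        by (simp only: prod_uminus p prod.neutral_const mult_1_right)
    qed
    finally show ?thesis .
  qed
  thus ?thesis unfolding c sum_distrib_left by (subst sum.swap) simp
qed

text \<open>For a set B of primes up to z, the conditions combine into divisibility by d =
  \<open>\<Prod>B\<close>, and d \<le> z^z leaves room W in \<open>n div d\<close>. The main terms
  recombine into the product; there are at most 2^z error terms.\<close>

lemma sieve_small_primes:
  fixes P :: "real poly"
  assumes eq: "divisor_equidist P W E" and "E \<ge> 0" "z \<ge> 1" "z ^ z * W \<le> n"
  shows "\<bar>real (card {x \<in> {1..n}. \<forall>p\<in>{p. prime p \<and> p \<le> z}. \<not> (p dvd x \<and> int p dvd \<lfloor>poly P (real x)\<rfloor>)}) -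
      real n * (\<Prod>p | prime p \<and> p \<le> z. 1 - 1 / (real p)\<^sup>2)\<bar> \<le> 2 ^ z * (E * real n + 1)"
proof -
  define T where "T = {p. prime p \<and> p \<le> z}"
  define b where "b = (\<lambda>p x. p dvd x \<and> int p dvd \<lfloor>poly P (real x)\<rfloor>)"
  have T: "T \<subseteq> {1..z}" by (auto simp: T_def Suc_le_eq prime_gt_0_nat)
  hence finT: "finite T" by (rule finite_subset) auto
  have cT: "card T \<le> z" using card_mono[OF _ T] by simp
  have B: "\<bar>real (card {x \<in> {1..n}. \<forall>p\<in>B. b p x}) - real n / (real (\<Prod>B))\<^sup>2\<bar> \<le> E * real n + 1"
    if "B \<in> Pow T" for B
  proof -
    have finB: "finite B" and pB: "\<And>p. p \<in> B \<Longrightarrow> prime p" "B \<subseteq> T"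
      using that finT by (auto intro: finite_subset simp: T_def)
    define d where "d = \<Prod>B"
    have d1: "d \<ge> 1" unfolding d_def using pB(1) by (intro prod_ge_1) (auto simp: Suc_le_eq prime_gt_0_nat)
    have "d \<le> (\<Prod>p\<in>B. z)" unfolding d_def using pB(2) T by (intro prod_mono) auto
    also have "\<dots> = z ^ card B" by simp
    also have "\<dots> \<le> z ^ z"
      using card_mono[OF finT pB(2)] cT assms(3) by (intro power_increasing) auto
    finally have "d * W \<le> z ^ z * W" by (intro mult_right_mono) auto
    hence "d * W \<le> n" using assms(4) by linarith
    hence "W \<le> n div d" using d1 by (simp add: less_eq_div_iff_mult_less_eq mult.commute)
    have "(\<forall>p\<in>B. b p x) \<longleftrightarrow> d dvd x \<and> int d dvd \<lfloor>poly P (real x)\<rfloor>" for x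
    proof -
      have dx: "d dvd x \<longleftrightarrow> (\<forall>p\<in>B. p dvd x)" unfolding d_def by (rule prod_primes_dvd[OF finB pB(1)])
      have "int d = \<Prod>(int ` B)" unfolding d_def by (simp add: prod.reindex)
      moreover have "prime q" if "q \<in> int ` B" for q using that pB(1) by auto
      ultimately have "int d dvd \<lfloor>poly P (real x)\<rfloor> \<longleftrightarrow> (\<forall>p\<in>B. int p dvd \<lfloor>poly P (real x)\<rfloor>)"
        using prod_primes_dvd[of "int ` B" "\<lfloor>poly P (real x)\<rfloor>"] finB by simp
      thus ?thesis using dx by (auto simp: b_def)
    qed
    hence "\<bar>real (card {x \<in> {1..n}. \<forall>p\<in>B. b p x}) - real n / (real d)\<^sup>2\<bar> \<le>
        E * (real n / real d) + 1 / real d"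
      using eq d1 \<open>W \<le> n div d\<close> by (simp add: divisor_equidist_def)
    also have "\<dots> \<le> E * (real n / 1) + 1 / 1"
      using d1 \<open>E \<ge> 0\<close> by (intro add_mono mult_left_mono divide_left_mono) auto
    finally show ?thesis by (simp add: d_def)
  qed
  have "real n * (\<Prod>p\<in>T. 1 - 1 / (real p)\<^sup>2) = real n * (\<Prod>p\<in>T. (- (1 / (real p)\<^sup>2)) + 1)"
    by simp
  also have "(\<Prod>p\<in>T. (- (1 / (real p)\<^sup>2)) + 1) = (\<Sum>B\<in>Pow T. (\<Prod>p\<in>B. - (1 / (real p)\<^sup>2)) * (\<Prod>p\<in>T - B. 1))"
    by (rule prod_add[OF finT])
  also have "real n * \<dots> = (\<Sum>B\<in>Pow T. (-1) ^ card B * (real n / (real (\<Prod>B))\<^sup>2))"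
    unfolding sum_distrib_left
    by (intro sum.cong[OF refl]) (simp add: prod_uminus prod_dividef prod_power_distrib)
  finally have main: "real n * (\<Prod>p\<in>T. 1 - 1 / (real p)\<^sup>2) =
      (\<Sum>B\<in>Pow T. (-1) ^ card B * (real n / (real (\<Prod>B))\<^sup>2))" .
  have "\<bar>real (card {x \<in> {1..n}. \<forall>p\<in>T. \<not> b p x}) - real n * (\<Prod>p\<in>T. 1 - 1 / (real p)\<^sup>2)\<bar> =
      \<bar>\<Sum>B\<in>Pow T. (-1) ^ card B * (real (card {x \<in> {1..n}. \<forall>p\<in>B. b p x}) - real n / (real (\<Prod>B))\<^sup>2)\<bar>"
    unfolding main card_sieve[OF finite_atLeastAtMost finT] right_diff_distrib sum_subtractf ..
  also have "\<dots> \<le> (\<Sum>B\<in>Pow T. \<bar>(-1) ^ card B * (real (card {x \<in> {1..n}. \<forall>p\<in>B. b p x}) - real n / (real (\<Prod>B))\<^sup>2)\<bar>)"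
    by (rule sum_abs)
  also have "\<dots> \<le> (\<Sum>B\<in>Pow T. E * real n + 1)"
    using B by (intro sum_mono) (simp add: abs_mult power_abs)
  also have "\<dots> = 2 ^ card T * (E * real n + 1)" using finT by (simp add: card_Pow)
  also have "\<dots> \<le> 2 ^ z * (E * real n + 1)"
    using cT \<open>E \<ge> 0\<close> by (intro mult_right_mono power_increasing) auto
  finally show ?thesis by (simp add: T_def b_def)
qed

text \<open>Up to m the joint divisibility is counted by equidistribution. Beyond m the condition on
  the floor is dropped: the multiples of p number at most n / p, and the reciprocals of these primes
  are summed over I dyadic blocks.\<close>

lemma card_large_primes:
  fixes P :: "real poly"
  assumes eq: "divisor_equidist P W E" and "E \<ge> 0" "z \<ge> 1" "W \<ge> 1"
    and m: "m = n div W" "m \<ge> 2" "n \<le> m * 2 ^ I"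
  shows "real (card {x \<in> {1..n}. \<exists>p. prime p \<and> z < p \<and> p dvd x \<and> int p dvd \<lfloor>poly P (real x)\<rfloor>}) \<le>
     real n / real z + (E * real n + 1) * (1 + ln (real n)) + real n * (2 * real I * ln 2 / ln (real m))"
proof -
  define A where "A = (\<lambda>p. {x \<in> {1..n}. p dvd x \<and> int p dvd \<lfloor>poly P (real x)\<rfloor>})"
  define L where "L = {p. prime p \<and> m < p \<and> p \<le> m * 2 ^ I}"
  define D where "D = (\<lambda>p. {x \<in> {1..n}. p dvd x})"
  have finL: "finite L" by (rule finite_subset[of _ "{..m * 2 ^ I}"]) (auto simp: L_def)
  have mn: "m \<le> n" by (simp add: m(1))
  hence mn: "m \<le> n" "1 \<le> n" using m(2) by linarith+
  have "{x \<in> {1..n}. \<exists>p. prime p \<and> z < p \<and> p dvd x \<and> int p dvd \<lfloor>poly P (real x)\<rfloor>} \<subseteq>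
      (\<Union>p\<in>{z<..m}. A p) \<union> (\<Union>p\<in>L. D p)"
  proof
    fix x assume "x \<in> {x \<in> {1..n}. \<exists>p. prime p \<and> z < p \<and> p dvd x \<and> int p dvd \<lfloor>poly P (real x)\<rfloor>}"
    then obtain p where x: "x \<in> {1..n}" and p: "prime p" "z < p" "p dvd x" "int p dvd \<lfloor>poly P (real x)\<rfloor>"
      by blast
    have "p \<le> n" using x p(3) dvd_imp_le[of p x] by simp
    thus "x \<in> (\<Union>p\<in>{z<..m}. A p) \<union> (\<Union>p\<in>L. D p)"
      using x p m(3) by (cases "p \<le> m") (auto simp: A_def L_def D_def)
  qed
  hence "card {x \<in> {1..n}. \<exists>p. prime p \<and> z < p \<and> p dvd x \<and> int p dvd \<lfloor>poly P (real x)\<rfloor>} \<le>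
      card ((\<Union>p\<in>{z<..m}. A p) \<union> (\<Union>p\<in>L. D p))"
    using finL by (intro card_mono) (auto simp: A_def D_def)
  also have "\<dots> \<le> card (\<Union>p\<in>{z<..m}. A p) + card (\<Union>p\<in>L. D p)" by (rule card_Un_le)
  also have "\<dots> \<le> (\<Sum>p\<in>{z<..m}. card (A p)) + (\<Sum>p\<in>L. card (D p))"
    using finL by (intro add_mono card_UN_le) auto
  finally have "real (card {x \<in> {1..n}. \<exists>p. prime p \<and> z < p \<and> p dvd x \<and> int p dvd \<lfloor>poly P (real x)\<rfloor>}) \<le>
      (\<Sum>p\<in>{z<..m}. real (card (A p))) + (\<Sum>p\<in>L. real (card (D p)))"
    by (simp flip: of_nat_sum of_nat_add)
  \<comment> \<open>The union runs over all integers from z to m, not only primes; the price is the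
    harmonic sum, hence the factor 1 + ln n.\<close>
  also have "(\<Sum>p\<in>{z<..m}. real (card (A p))) \<le>
      (\<Sum>p\<in>{z<..m}. real n * (1 / (real p)\<^sup>2) + (E * real n + 1) * (1 / real p))"
  proof (rule sum_mono)
    fix p assume p: "p \<in> {z<..m}"
    hence "p * W \<le> m * W" by (intro mult_right_mono) auto
    also have "\<dots> \<le> n" unfolding m(1) by simp
    finally have "W \<le> n div p" using p by (simp add: less_eq_div_iff_mult_less_eq mult.commute)
    hence "\<bar>real (card (A p)) - real n / (real p)\<^sup>2\<bar> \<le> E * (real n / real p) + 1 / real p"
      using eq p unfolding A_def divisor_equidist_def by simp
    thus "real (card (A p)) \<le> real n * (1 / (real p)\<^sup>2) + (E * real n + 1) * (1 / real p)"
      by (simp add: algebra_simps add_divide_distrib abs_le_iff)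
  qed
  also have "\<dots> = real n * (\<Sum>p\<in>{z<..m}. 1 / (real p)\<^sup>2) + (E * real n + 1) * (\<Sum>p\<in>{z<..m}. 1 / real p)"
    by (simp only: sum.distrib sum_distrib_left)
  also have "\<dots> \<le> real n * (1 / real z) + (E * real n + 1) * (1 + ln (real n))"
  proof (intro add_mono mult_left_mono)
    show "(\<Sum>p\<in>{z<..m}. 1 / (real p)\<^sup>2) \<le> 1 / real z"
      by (rule sum_inverse_squares_le) (use assms in auto)
    have "(\<Sum>p\<in>{z<..m}. 1 / real p) \<le> (\<Sum>p\<in>{1..n}. 1 / real p)"
      using mn by (intro sum_mono2) auto
    also have "\<dots> \<le> 1 + ln (real n)" by (rule sum_inverse_le_ln[OF mn(2)])
    finally show "(\<Sum>p\<in>{z<..m}. 1 / real p) \<le> 1 + ln (real n)" .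
  qed (use \<open>E \<ge> 0\<close> in auto)
  also have "(\<Sum>p\<in>L. real (card (D p))) \<le> (\<Sum>p\<in>L. real n * (1 / real p))"
  proof (rule sum_mono)
    fix p assume "p \<in> L"
    hence "p \<ge> 1" by (auto simp: L_def Suc_le_eq prime_gt_0_nat)
    \<comment> \<open>Taking the zero polynomial makes the floor condition vacuous, so plain
      multiples of p are counted.\<close>
    hence "card (D p) = card {y \<in> {1..n div p}. True}"
      using card_multiples_dvd_floor[of p n 0] by (simp add: D_def)
    also have "{y \<in> {1..n div p}. True} = {1..n div p}" by auto
    finally have "card (D p) = n div p" by simp
    thus "real (card (D p)) \<le> real n * (1 / real p)" using real_div_bounds(1)[OF \<open>p \<ge> 1\<close>, of n] by simp
  qed
  also have "\<dots> = real n * (\<Sum>p\<in>L. 1 / real p)" by (simp only: sum_distrib_left)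
  also have "\<dots> \<le> real n * (2 * real I * ln 2 / ln (real m))"
    unfolding L_def by (intro mult_left_mono sum_inverse_primes_dyadic m) auto
  finally show ?thesis by simp
qed

section \<open>Assembling the count\<close>

lemma coprime_floor_count_eq:
  "coprime_floor_count P X = card {x \<in> {1..nat \<lfloor>X\<rfloor>}. gcd (int x) \<lfloor>poly P (real x)\<rfloor> = 1}"
proof -
  have "real x \<le> X \<longleftrightarrow> x \<le> nat \<lfloor>X\<rfloor>" if "1 \<le> x" for x
    using that by (simp add: le_nat_floor le_floor_iff nat_le_iff le_nat_iff) linarith
  thus ?thesis unfolding coprime_floor_count_def by (intro arg_cong[where f = card]) auto
qed

text \<open>The coprime x all survive the sieve by primes up to z, and a survivor that is not
  coprime has a common prime factor above z. The term n / z occurs twice, once from large primes and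
  once from truncating the Euler product.\<close>

lemma coprime_count_bound:
  fixes P :: "real poly"
  assumes eq: "divisor_equidist P W E" and "E \<ge> 0" "z \<ge> 1" "W \<ge> 1"
    and m: "m = n div W" "m \<ge> 2" "n \<le> m * 2 ^ I" and z: "z ^ z * W \<le> n"
  shows "\<bar>real (card {x \<in> {1..n}. gcd (int x) \<lfloor>poly P (real x)\<rfloor> = 1}) - real n / zeta 2\<bar> \<le>
    2 * (real n / real z) + (E * real n + 1) * (2 ^ z + 1 + ln (real n)) + real n * (2 * real I * ln 2 / ln (real m))"
proof -
  define C where "C = {x \<in> {1..n}. gcd (int x) \<lfloor>poly P (real x)\<rfloor> = 1}"
  define S where "S = {x \<in> {1..n}. \<forall>p\<in>{p. prime p \<and> p \<le> z}. \<not> (p dvd x \<and> int p dvd \<lfloor>poly P (real x)\<rfloor>)}"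
  define B where "B = {x \<in> {1..n}. \<exists>p. prime p \<and> z < p \<and> p dvd x \<and> int p dvd \<lfloor>poly P (real x)\<rfloor>}"
  define V where "V = (\<Prod>p | prime p \<and> p \<le> z. 1 - 1 / (real p)\<^sup>2)"
  have fin: "finite C" "finite S" "finite B" by (auto simp: C_def S_def B_def)
  have "C \<subseteq> S"
  proof
    fix x assume x: "x \<in> C"
    have "\<not> (p dvd x \<and> int p dvd \<lfloor>poly P (real x)\<rfloor>)" if "prime p" for p
    proof
      assume "p dvd x \<and> int p dvd \<lfloor>poly P (real x)\<rfloor>"
      hence "int p dvd gcd (int x) \<lfloor>poly P (real x)\<rfloor>" by (intro gcd_greatest) auto
      also have "gcd (int x) \<lfloor>poly P (real x)\<rfloor> = 1" using x by (simp add: C_def)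
      finally have "p = 1" by simp
      thus False using that by simp
    qed
    thus "x \<in> S" using x by (auto simp: S_def C_def)
  qed
  moreover have "S \<subseteq> C \<union> B"
  proof
    fix x assume x: "x \<in> S"
    show "x \<in> C \<union> B"
    proof (cases "gcd (int x) \<lfloor>poly P (real x)\<rfloor> = 1")
      case False
      hence "nat (gcd (int x) \<lfloor>poly P (real x)\<rfloor>) \<noteq> 1" by (simp add: nat_eq_iff)
      then obtain p where p: "prime p" "p dvd nat (gcd (int x) \<lfloor>poly P (real x)\<rfloor>)"
        using prime_factor_nat by blast
      hence "int p dvd int (nat (gcd (int x) \<lfloor>poly P (real x)\<rfloor>))" by (simp only: of_nat_dvd_iff)
      hence "p dvd x \<and> int p dvd \<lfloor>poly P (real x)\<rfloor>" by simp
      moreover from this have "z < p" using x p(1) by (auto simp: S_def not_le[symmetric])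
      ultimately show ?thesis using x p(1) by (auto simp: S_def B_def)
    qed (use x in \<open>auto simp: S_def C_def\<close>)
  qed
  ultimately have "card C \<le> card S" "card S \<le> card C + card B"
    using fin card_mono[of S C] card_mono[of "C \<union> B" S] card_Un_le[of C B] by auto
  hence CS: "\<bar>real (card C) - real (card S)\<bar> \<le> real (card B)" by linarith
  have "\<bar>real (card S) - real n * V\<bar> \<le> 2 ^ z * (E * real n + 1)"
    unfolding S_def V_def by (rule sieve_small_primes[OF eq assms(2,3) z])
  moreover have "real (card B) \<le>
      real n / real z + (E * real n + 1) * (1 + ln (real n)) + real n * (2 * real I * ln 2 / ln (real m))"
    unfolding B_def by (rule card_large_primes[OF eq assms(2-4) m])
  moreover have "\<bar>real n * V - real n / zeta 2\<bar> \<le> real n / real z"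
  proof -
    have "\<bar>real n * V - real n / zeta 2\<bar> = real n * \<bar>V - 1 / zeta 2\<bar>"
    proof -
      have "real n * V - real n / zeta 2 = real n * (V - 1 / zeta 2)" by (simp add: right_diff_distrib)
      thus ?thesis by (simp only: abs_mult abs_of_nat)
    qed
    also have "\<dots> \<le> real n * (1 / real z)"
      unfolding V_def by (intro mult_left_mono euler_product_zeta_2 assms) auto
    finally show ?thesis by simp
  qed
  moreover have "(E * real n + 1) * (2 ^ z + 1 + ln (real n)) =
      2 ^ z * (E * real n + 1) + (E * real n + 1) * (1 + ln (real n))" by (simp add: algebra_simps)
  ultimately show ?thesis using CS unfolding C_def[symmetric] by linarith
qed

section \<open>Choice of parameters\<close>

lemma two_power_le_exp: "2 ^ j \<le> exp (real j)"
proof -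
  have "(2::real) ^ j \<le> exp 1 ^ j" using exp_ge_add_one_self[of 1] by (intro power_mono) auto
  thus ?thesis by (simp flip: exp_of_nat_mult)
qed

text \<open>Take z = \<lfloor>ln ln n\<rfloor> and G exponential in z. Then G beats both 2^z and ln
  n, while W is at most a power of ln n, so few dyadic blocks separate n / W from n. Every error
  becomes O(n / z).\<close>

lemma coprime_count_asymptotic:
  assumes "\<not> liouville (coeff P 1)"
  shows "\<forall>\<^sub>F n in sequentially. \<bar>real (card {x \<in> {1..n}. gcd (int x) \<lfloor>poly P (real x)\<rfloor> = 1}) - real n / zeta 2\<bar>
    \<le> 162 * real n / ln (ln (real n))"
proof -
  obtain K where K: "\<And>G. G \<ge> 2 \<Longrightarrow> divisor_equidist P (G ^ K + 1) (25 / real G)"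
    using divisor_equidist_not_liouville[OF assms] by blast
  define k where "k = real K"
  \<comment> \<open>The first inequality will put G, 4 W^2 and z^z W below exp(exp z), hence below
    n. The second makes the large-prime error at most n / z.\<close>
  have "\<forall>\<^sub>F z :: real in at_top. z ^ 2 + (8 * z + 8) * k + 4 * z + 8 \<le> exp z"
    by real_asymp
  moreover have "\<forall>\<^sub>F z :: real in at_top. 4 * ((4 * z + 4) * k + 2) * z \<le> exp z"
    by real_asymp
  ultimately have "\<forall>\<^sub>F z :: real in at_top. z ^ 2 + (8 * z + 8) * k + 4 * z + 8 \<le> exp z \<and>
      4 * ((4 * z + 4) * k + 2) * z \<le> exp z" by eventually_elim simp
  then obtain z0 where z0: "\<And>z. z \<ge> z0 \<Longrightarrow> z ^ 2 + (8 * z + 8) * k + 4 * z + 8 \<le> exp z"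
      "\<And>z. z \<ge> z0 \<Longrightarrow> 4 * ((4 * z + 4) * k + 2) * z \<le> exp z"
    by (auto simp: eventually_at_top_linorder)
  \<comment> \<open>The extra 1 makes up for the floor in the choice of z.\<close>
  have "\<forall>\<^sub>F n in sequentially. max z0 1 + 1 \<le> ln (ln (real n))" by real_asymp
  moreover have "\<forall>\<^sub>F n in sequentially. 1 < ln (real n)" by real_asymp
  ultimately show ?thesis
  proof eventually_elim
    fix n :: nat assume n: "max z0 1 + 1 \<le> ln (ln (real n))" and n1: "1 < ln (real n)"
    have n0: "real n > 1"
    proof (rule ccontr)
      assume "\<not> real n > 1"
      hence "n = 0 \<or> n = 1" by auto
      thus False using n1 by auto
    qed
    define z where "z = nat \<lfloor>ln (ln (real n))\<rfloor>"
    have z: "real z \<le> ln (ln (real n))" "ln (ln (real n)) < real z + 1" "z0 \<le> real z" "1 \<le> z"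
      using n unfolding z_def by linarith+
    have lnn: "exp (real z) \<le> ln (real n)" "ln (real n) \<le> exp (real z + 1)"
    proof -
      have e: "exp (ln (ln (real n))) = ln (real n)" using n1 by simp
      show "exp (real z) \<le> ln (real n)" using z(1) by (subst e[symmetric]) simp
      show "ln (real n) \<le> exp (real z + 1)" using z(2) by (subst e[symmetric]) simp
    qed
    have big: "x \<le> real n" if "x \<le> exp (exp (real z))" for x
    proof -
      have "exp (exp (real z)) \<le> exp (ln (real n))" using lnn(1) by simp
      thus ?thesis using that n0 by simp
    qed
    define s where "s = (4 * z + 4) * K"
    have s: "(8 * real z + 8) * k = 2 * real s" by (simp add: s_def k_def algebra_simps)
    have zz: "real z ^ 2 + 2 * real s + 4 * real z + 8 \<le> exp (real z)"
      using z0(1)[OF z(3)] s by simp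
    have zs: "real (4 * z + 4) \<le> exp (real z)" "real (2 * s + 4) \<le> exp (real z)"
        "real z ^ 2 + real (s + 1) \<le> exp (real z)"
      using zz zero_le_power2[of "real z"] of_nat_0_le_iff[of s] of_nat_0_le_iff[of z]
      unfolding of_nat_add of_nat_mult of_nat_numeral of_nat_1 by linarith+
    \<comment> \<open>G is the square of 4^(z + 1): one factor cancels 2^z + 1 + ln n, the other
      leaves n / 4^(z + 1), which is at most n / z. Also G^K = 2^s.\<close>
    define G :: nat where "G = 2 ^ (4 * z + 4)"
    define W where "W = G ^ K + 1"
    define m where "m = n div W"
    have G16: "real G = 4 ^ (z + 1) * 4 ^ (z + 1)"
    proof -
      have "(2::real) ^ (4 * z + 4) = 2 ^ (2 * (z + 1)) * 2 ^ (2 * (z + 1))"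
        unfolding power_add[symmetric] by (rule arg_cong[where f = "power 2"]) simp
      also have "(2::real) ^ (2 * (z + 1)) = 4 ^ (z + 1)" by (subst power_mult) simp
      finally show ?thesis by (simp add: G_def)
    qed
    have G2: "G \<ge> 2" using power_increasing[of 1 "4 * z + 4" "2::nat"] by (simp add: G_def)
    have Gn: "real G \<le> real n"
    proof (rule big)
      have "real G \<le> exp (real (4 * z + 4))" using two_power_le_exp[of "4 * z + 4"] by (simp add: G_def)
      also have "\<dots> \<le> exp (exp (real z))" using zs(1) by simp
      finally show "real G \<le> exp (exp (real z))" .
    qed
    have Gs: "G ^ K = 2 ^ s" by (simp add: G_def s_def power_mult)
    have "1 \<le> (2::nat) ^ s" by simp
    hence W: "W \<ge> 2" "W \<le> 2 ^ (s + 1)" by (simp_all add: W_def Gs)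
    have W': "real W \<le> 2 ^ (s + 1)" using W(2) by (metis of_nat_le_iff of_nat_numeral of_nat_power)
    have W4: "4 * (real W)\<^sup>2 \<le> real n"
    proof (rule big)
      have "4 * (real W)\<^sup>2 \<le> 4 * (2 ^ (s + 1))\<^sup>2" using W' by (intro mult_left_mono power_mono) auto
      also have "\<dots> = 2 ^ (2 * s + 4)" by (simp add: power_add power_mult power2_eq_square flip: power_mult_distrib)
      also have "\<dots> \<le> exp (real (2 * s + 4))" by (rule two_power_le_exp)
      also have "\<dots> \<le> exp (exp (real z))" using zs(2) by simp
      finally show "4 * (real W)\<^sup>2 \<le> exp (exp (real z))" .
    qed
    have zW: "z ^ z * W \<le> n"
    proof -
      have "real z ^ z * real W \<le> real n"
      proof (rule big)
        have "real z \<le> exp (real z)" using exp_ge_add_one_self[of "real z"] by linarith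
        hence "real z ^ z \<le> exp (real z) ^ z" by (intro power_mono) auto
        also have "\<dots> = exp (real z ^ 2)" by (simp add: power2_eq_square flip: exp_of_nat_mult)
        finally have "real z ^ z * real W \<le> exp (real z ^ 2) * 2 ^ (s + 1)"
          using W' by (intro mult_mono) auto
        also have "\<dots> \<le> exp (real z ^ 2) * exp (real (s + 1))"
          by (intro mult_left_mono two_power_le_exp) auto
        also have "\<dots> \<le> exp (exp (real z))" using zs(3) by (simp flip: exp_add)
        finally show "real z ^ z * real W \<le> exp (exp (real z))" .
      qed
      hence "real (z ^ z * W) \<le> real n" by simp
      thus ?thesis by (simp only: of_nat_le_iff)
    qed
    have m_ge: "real n / (2 * real W) \<le> real m"
    proof -
      have "2 * real W * 1 \<le> 2 * real W * (2 * real W)" using W(1) by (intro mult_left_mono) auto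
      hence "2 * real W \<le> real n" using W4 by (simp add: power2_eq_square)
      hence "real n / (2 * real W) \<le> real n / real W - 1" using W(1) by (simp add: field_simps)
      also have "\<dots> \<le> real m" unfolding m_def using W(1) by (intro real_div_bounds) simp
      finally show ?thesis .
    qed
    have "2 * real W \<le> real n / (2 * real W)"
      using W4 W(1) by (simp add: field_simps power2_eq_square)
    hence m2: "real m \<ge> 2 * real W" using m_ge by linarith
    hence m4: "m \<ge> 2" using W(1) by linarith
    have nm: "real n \<le> 2 * real W * real m" using m_ge W(1) by (simp add: field_simps)
    \<comment> \<open>Since n \<le> 2 W m and W \<le> 2^(s + 1), s + 2 dyadic blocks lead from m
      past n.\<close>
    have nI: "n \<le> m * 2 ^ (s + 2)"
    proof -
      have "real n \<le> real (2 * W * m)" using nm by simp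
      hence "n \<le> 2 * W * m" by (simp only: of_nat_le_iff)
      also have "\<dots> \<le> 2 * 2 ^ (s + 1) * m" using W(2) by (intro mult_right_mono) auto
      finally show ?thesis by (simp add: mult_ac)
    qed
    \<comment> \<open>m \<ge> 2 W and n \<le> 2 W m give n \<le> m^2.\<close>
    have lnm: "ln (real n) / 2 \<le> ln (real m)"
    proof -
      have "real n \<le> real m * real m"
        using nm mult_right_mono[OF m2, of "real m"] by simp
      hence "ln (real n) \<le> ln (real m * real m)" using n0 m4 by (subst ln_le_cancel_iff) auto
      also have "\<dots> = 2 * ln (real m)" using m4 by (simp add: ln_mult)
      finally show ?thesis by simp
    qed
    have z4: "real z \<le> 4 ^ (z + 1)"
    proof -
      have "real z \<le> 2 ^ z" using less_exp[of z] by (metis less_imp_le of_nat_le_iff of_nat_numeral of_nat_power)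
      also have "\<dots> \<le> 4 ^ z" by (intro power_mono) auto
      also have "\<dots> \<le> 4 ^ (z + 1)" by (intro power_increasing) auto
      finally show ?thesis .
    qed
    have t2: "(25 / real G * real n + 1) * (2 ^ z + 1 + ln (real n)) \<le> 78 * (real n / real z)"
    proof -
      have "1 \<le> real n / real G" using Gn G2 by simp
      hence a: "25 / real G * real n + 1 \<le> 26 * (real n / real G)" by simp
      have "exp (real z + 1) = exp (real (z + 1) * 1)" by (simp add: add.commute)
      also have "\<dots> = exp 1 ^ (z + 1)" by (rule exp_of_nat_mult)
      also have "\<dots> \<le> 4 ^ (z + 1)" using exp_le by (intro power_mono) auto
      finally have "ln (real n) \<le> 4 ^ (z + 1)" using lnn(2) by linarith
      moreover have "(2::real) ^ z \<le> 4 ^ (z + 1)"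
      proof -
        have "(2::real) ^ z \<le> 4 ^ z" by (intro power_mono) auto
        also have "\<dots> \<le> 4 ^ (z + 1)" by (intro power_increasing) auto
        finally show ?thesis .
      qed
      moreover have "(1::real) \<le> 4 ^ (z + 1)" by (rule one_le_power) simp
      ultimately have b: "2 ^ z + 1 + ln (real n) \<le> 3 * 4 ^ (z + 1)" by linarith
      have "(25 / real G * real n + 1) * (2 ^ z + 1 + ln (real n)) \<le> 26 * (real n / real G) * (3 * 4 ^ (z + 1))"
        using a b n1 by (intro mult_mono) auto
      also have "\<dots> = 78 * (real n / 4 ^ (z + 1))" unfolding G16 by simp
      also have "\<dots> \<le> 78 * (real n / real z)"
        using z4 z(4) by (intro mult_left_mono divide_left_mono) auto
      finally show ?thesis .
    qed
    have t3: "real n * (2 * real (s + 2) * ln 2 / ln (real m)) \<le> real n / real z"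
    proof -
      have "2 * real (s + 2) * ln 2 / ln (real m) \<le> 2 * real (s + 2) * 1 / (ln (real n) / 2)"
        using lnm n1 ln_2_less_1 m4 by (intro frac_le mult_left_mono) auto
      also have "\<dots> = 4 * real (s + 2) / ln (real n)" by simp
      also have "\<dots> \<le> 4 * real (s + 2) / exp (real z)"
        using lnn(1) n1 by (intro divide_left_mono) auto
      also have "\<dots> \<le> 1 / real z"
        using z0(2)[OF z(3)] z(4) by (simp add: s_def k_def field_simps)
      finally have "real n * (2 * real (s + 2) * ln 2 / ln (real m)) \<le> real n * (1 / real z)"
        by (intro mult_left_mono) auto
      thus ?thesis by simp
    qed
    have "\<bar>real (card {x \<in> {1..n}. gcd (int x) \<lfloor>poly P (real x)\<rfloor> = 1}) - real n / zeta 2\<bar> \<le>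
        2 * (real n / real z) + (25 / real G * real n + 1) * (2 ^ z + 1 + ln (real n)) +
        real n * (2 * real (s + 2) * ln 2 / ln (real m))"
      using coprime_count_bound[OF K[OF G2, folded W_def] _ z(4) _ m_def m4 nI zW] W(1) by simp
    \<comment> \<open>81 = 2 + 78 + 1. It doubles in the next step, where z is replaced by half of
      ln ln n.\<close>
    also have "\<dots> \<le> 81 * (real n / real z)" using t2 t3 by linarith
    also have "\<dots> \<le> 81 * (real n / (ln (ln (real n)) / 2))"
      using z n by (intro mult_left_mono divide_left_mono mult_pos_pos) auto
    finally show "\<bar>real (card {x \<in> {1..n}. gcd (int x) \<lfloor>poly P (real x)\<rfloor> = 1}) - real n / zeta 2\<bar>
        \<le> 162 * real n / ln (ln (real n))" by simp
  qed
qed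

theorem theorem4p2:
  fixes P :: "real poly"
  assumes "\<not> liouville (coeff P 1)"
  shows "(\<lambda>X. real (coprime_floor_count P X) - X / zeta 2)
           \<in> O[at_top](\<lambda>X::real. X / (ln (ln X)) powr (1 / 3)) \<and>
         ((\<lambda>X::real. real (coprime_floor_count P X) / X) \<longlongrightarrow> 1 / zeta 2) at_top"
proof -
  have "filterlim (\<lambda>X::real. nat \<lfloor>X\<rfloor>) sequentially at_top"
    by (rule filterlim_compose[OF filterlim_nat_sequentially filterlim_floor_sequentially])
  from eventually_compose_filterlim[OF coprime_count_asymptotic[OF assms] this]
  have ev: "\<forall>\<^sub>F X :: real in at_top. \<bar>real (coprime_floor_count P X) - real (nat \<lfloor>X\<rfloor>) / zeta 2\<bar>
      \<le> 162 * real (nat \<lfloor>X\<rfloor>) / ln (ln (real (nat \<lfloor>X\<rfloor>)))"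
    unfolding coprime_floor_count_eq .
  \<comment> \<open>The first fact passes from X to its floor, which is at least X / 2. The third
    weakens the saving ln ln X obtained so far to its cube root.\<close>
  have asymp: "\<forall>\<^sub>F X :: real in at_top. ln (ln X) / 2 \<le> ln (ln (X / 2))"
      "\<forall>\<^sub>F X :: real in at_top. 1 \<le> X / (ln (ln X)) powr (1 / 3)"
      "\<forall>\<^sub>F X :: real in at_top. X / ln (ln X) \<le> X / (ln (ln X)) powr (1 / 3)"
      "\<forall>\<^sub>F X :: real in at_top. 1 < ln (X / 2)"
      "\<forall>\<^sub>F X :: real in at_top. 0 < ln (ln X)"
    by real_asymp+
  \<comment> \<open>325 = 2 * 162 + 1, where 1 accounts for replacing \<lfloor>X\<rfloor> /
    \<open>zeta 2\<close> by X / \<open>zeta 2\<close>.\<close>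
  have bound: "\<forall>\<^sub>F X :: real in at_top. \<bar>real (coprime_floor_count P X) - X / zeta 2\<bar>
      \<le> 325 * (X / (ln (ln X)) powr (1 / 3))"
    using ev asymp eventually_ge_at_top[of 4]
  proof eventually_elim
    fix X :: real
    assume X: "\<bar>real (coprime_floor_count P X) - real (nat \<lfloor>X\<rfloor>) / zeta 2\<bar>
        \<le> 162 * real (nat \<lfloor>X\<rfloor>) / ln (ln (real (nat \<lfloor>X\<rfloor>)))"
      and half: "ln (ln X) / 2 \<le> ln (ln (X / 2))" and one: "1 \<le> X / (ln (ln X)) powr (1 / 3)"
      and third: "X / ln (ln X) \<le> X / (ln (ln X)) powr (1 / 3)"
      and pos: "1 < ln (X / 2)" "0 < ln (ln X)" and X4: "4 \<le> X"
    define n where "n = nat \<lfloor>X\<rfloor>"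
    have n: "real n \<le> X" "X - 1 \<le> real n" "X / 2 \<le> real n" using X4 unfolding n_def by linarith+
    have "ln (X / 2) \<le> ln (real n)" using n X4 by (subst ln_le_cancel_iff) auto
    hence "ln (ln (X / 2)) \<le> ln (ln (real n))" using pos by (subst ln_le_cancel_iff) auto
    hence ll: "ln (ln X) / 2 \<le> ln (ln (real n))" using half by linarith
    have "\<bar>real n / zeta 2 - X / zeta 2\<bar> = \<bar>real n - X\<bar> / zeta 2"
      using zeta_2_ge_1 by (simp add: abs_divide flip: diff_divide_distrib)
    also have "\<dots> \<le> 1 / 1" using n zeta_2_ge_1 by (intro frac_le) auto
    finally have "\<bar>real n / zeta 2 - X / zeta 2\<bar> \<le> 1" by simp
    moreover have "162 * real n / ln (ln (real n)) \<le> 162 * X / (ln (ln X) / 2)"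
      using n ll pos X4 by (intro frac_le) auto
    hence "162 * real n / ln (ln (real n)) \<le> 324 * (X / ln (ln X))" by simp
    ultimately show "\<bar>real (coprime_floor_count P X) - X / zeta 2\<bar> \<le> 325 * (X / (ln (ln X)) powr (1 / 3))"
      using X one third unfolding n_def[symmetric] by linarith
  qed
  have "(\<lambda>X. real (coprime_floor_count P X) - X / zeta 2) \<in> O[at_top](\<lambda>X::real. X / (ln (ln X)) powr (1 / 3))"
  proof (rule bigoI[where c = 325])
    show "\<forall>\<^sub>F X in at_top. norm (real (coprime_floor_count P X) - X / zeta 2)
        \<le> 325 * norm (X / (ln (ln X)) powr (1 / 3))"
      using bound eventually_ge_at_top[of 0] by eventually_elim (simp add: abs_mult)
  qed
  moreover have "((\<lambda>X::real. real (coprime_floor_count P X) / X) \<longlongrightarrow> 1 / zeta 2) at_top"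
  proof (rule LIM_zero_cancel, rule Lim_null_comparison)
    show "((\<lambda>X::real. 325 / (ln (ln X)) powr (1 / 3)) \<longlongrightarrow> 0) at_top" by real_asymp
    show "\<forall>\<^sub>F X in at_top. norm (real (coprime_floor_count P X) / X - 1 / zeta 2)
        \<le> 325 / (ln (ln X)) powr (1 / 3)"
      using bound eventually_gt_at_top[of 0]
    proof eventually_elim
      fix X :: real
      assume b: "\<bar>real (coprime_floor_count P X) - X / zeta 2\<bar> \<le> 325 * (X / (ln (ln X)) powr (1 / 3))"
        and X: "0 < X"
      have "real (coprime_floor_count P X) / X - 1 / zeta 2 = (real (coprime_floor_count P X) - X / zeta 2) / X"
        using X by (simp add: diff_divide_distrib)
      hence "norm (real (coprime_floor_count P X) / X - 1 / zeta 2) =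
          \<bar>real (coprime_floor_count P X) - X / zeta 2\<bar> / X"
        using X by (simp add: abs_divide)
      also have "\<dots> \<le> 325 * (X / (ln (ln X)) powr (1 / 3)) / X"
        using b X by (intro divide_right_mono) auto
      also have "\<dots> = 325 / (ln (ln X)) powr (1 / 3)" using X by simp
      finally show "norm (real (coprime_floor_count P X) / X - 1 / zeta 2) \<le> 325 / (ln (ln X)) powr (1 / 3)" .
    qed
  qed
  ultimately show ?thesis ..
qed

end
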